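(* Let $H \in \mathbb{R}^{2N\times 2N}$ be a real symmetric matrix and let $S_h \in \mathbb{C}^{2N\times 2N}$ be a family of complex symplectic matrices depending smoothly on $h\in \mathbb{R}$ such that (i) the spectrum of $S_h$ satisfies $\sigma(S_h) = \overline{\sigma(S_h)}$; (ii) $S_h$ is consistent with $\exp(hJH)$, i.e. there exists $p\geq 1$ such that $S_h = e^{hJH} + \mathcal{O}(h^{p+1})$ as $h\to 0$; (iii) the Hamiltonian system associated with $H$ is completely integrable, i.e. there exist a real symplectic matrix $P \in \mathbb{R}^{2N \times 2N}$ and real frequencies $\omega=(\omega_1,\ldots,\omega_N)$ such that $H = P^T D_\omega P$; (iv) the frequencies $\omega$ are non resonant, in the sense that the numbers $\omega_1, \ldots, \omega_N, -\omega_1, \ldots, -\omega_N$ are all distinct. Then there exist a vector $\omega_h\in\mathbb{R}^N$ of real frequencies depending smoothly on $h$ and a family $P_h$ of complex symplectic matrices depending smoothly on $h$ such that $P_h = P + \mathcal{O}(h^p)$, $\omega_h = \omega + \mathcal{O}(h^p)$ and, provided that $|h|$ is small enough, $$S_h = P_h^{-1} \, e^{hJ D_{\omega_h}} \, P_h.$$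
   Context: $J = \begin{pmatrix} O_N & I_N \\ -I_N & O_N\end{pmatrix}\in\mathbb{R}^{2N\times 2N}$. A real or complex $2N\times 2N$ matrix $S$ is symplectic if $S^T J S = J$ (transpose, no complex conjugation). For $\omega=(\omega_1,\ldots,\omega_N)\in \mathbb{R}^N$, $D_\omega$ is the $2N\times 2N$ diagonal matrix $D_\omega=\begin{pmatrix}\Delta_\omega & \\ & \Delta_\omega\end{pmatrix}$ with $\Delta_\omega=\mathrm{diag}(\omega_1,\ldots,\omega_N)$. $\sigma(A)$ is the set of eigenvalues of $A$, and $\overline{X}=\{\overline z: z\in X\}$ for $X\subset\mathbb{C}$. $N\ge1$ and $p\ge 1$ are integers. *)

theory Defs
  imports "HOL-Analysis.Analysis" "HOL-Library.Landau_Symbols"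
begin

text \<open>
  With \<open>N = CARD('n)\<close>, a \<open>2N \<times> 2N\<close> matrix is indexed by \<open>'n + 'n\<close>: the indices \<open>Inl k\<close> stand for
  the first block of \<open>N\<close> coordinates and \<open>Inr k\<close> for the second one.
\<close>

type_synonym ('a, 'n) block_matrix = "'a ^ ('n + 'n) ^ ('n + 'n)"

definition J_mat :: "('a::ring_1, 'n::finite) block_matrix" where
  "J_mat = (\<chi> i j. case (i, j) of
      (Inl k, Inr l) \<Rightarrow> if k = l then 1 else 0
    | (Inr k, Inl l) \<Rightarrow> if k = l then - 1 else 0
    | _ \<Rightarrow> 0)"

text \<open>The transpose carries no complex conjugation, also for complex matrices.\<close>

definition symplectic :: "('a::ring_1, 'n::finite) block_matrix \<Rightarrow> bool" where
  "symplectic S \<longleftrightarrow> transpose S ** J_mat ** S = J_mat"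

definition D_mat :: "real ^ 'n \<Rightarrow> (real, 'n::finite) block_matrix" where
  "D_mat \<omega> = (\<chi> i j. if i = j then case_sum (\<lambda>k. \<omega> $ k) (\<lambda>k. \<omega> $ k) i else 0)"

definition complex_mat :: "real ^ 'm::finite ^ 'm \<Rightarrow> complex ^ 'm ^ 'm" where
  "complex_mat A = map_matrix complex_of_real A"

definition spectrum :: "'a::field ^ 'm::finite ^ 'm \<Rightarrow> 'a set" where
  "spectrum A = {z. \<exists>v. v \<noteq> 0 \<and> A *v v = z *s v}"

text \<open>
  The library's multiplication \<open>*\<close> on \<open>'a ^ 'm ^ 'm\<close> is componentwise and the matrix product is
  \<open>**\<close>, so powers and the exponential series of a matrix are spelled out.
\<close>

definition mat_power :: "'a::semiring_1 ^ 'm::finite ^ 'm \<Rightarrow> nat \<Rightarrow> 'a ^ 'm ^ 'm" where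
  "mat_power A k = (((**) A) ^^ k) (mat 1)"

definition mat_exp :: "'a::real_normed_algebra_1 ^ 'm::finite ^ 'm \<Rightarrow> 'a ^ 'm ^ 'm" where
  "mat_exp A = (\<Sum>k. mat_power A k /\<^sub>R fact k)"

text \<open>\<open>C\<^sup>\<infinity>\<close> on the whole real line: every iterated derivative is differentiable everywhere.\<close>

definition smooth :: "(real \<Rightarrow> 'a::real_normed_vector) \<Rightarrow> bool" where
  "smooth f \<longleftrightarrow>
    (\<forall>k t. (((\<lambda>g s. vector_derivative g (at s)) ^^ k) f) differentiable (at t))"

definition non_resonant :: "real ^ 'n::finite \<Rightarrow> bool" where
  "non_resonant \<omega> \<longleftrightarrow> inj (case_sum (\<lambda>k. \<omega> $ k) (\<lambda>k. - \<omega> $ k))"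

end

theory Submission
  imports Defs "HOL-Computational_Algebra.Fundamental_Theorem_Algebra"
begin

text \<open>
  The idea is to apply perturbation theory of simple eigenvalues to a rescaled family.
  The columns of the constant symplectic matrix \<open>T\<close> (\<open>eigenbasis\<close>) are eigenvectors of every
  \<open>J D\<^sub>\<omega>\<close>, and \<open>J H = P\<^sup>-\<^sup>1 (J D\<^sub>\<omega>) P\<close> because \<open>P\<close> is symplectic.  With \<open>K = P\<^sup>-\<^sup>1 T\<close> the family
  \<open>G h = K\<^sup>-\<^sup>1 S\<^sub>h K\<close> is therefore symplectic, smooth, isospectral to \<open>S\<^sub>h\<close>, and equal up to
  \<open>O(h\<^sup>p\<^sup>+\<^sup>1)\<close> to the diagonal matrix of the numbers \<open>exp (\<plusminus>i h \<omega>\<^sub>k)\<close>.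

  At \<open>h = 0\<close> all eigenvalues of \<open>G\<close> coincide, so nothing can be said about them directly.  But
  \<open>B h = (G h - I) / h\<close> is smooth (\<open>hadamard_division\<close>), and \<open>B 0\<close> is diagonal with the entries
  \<open>\<plusminus>i \<omega>\<^sub>k\<close>, which are distinct by non-resonance.  Simple eigenvalues of a smooth family, and
  suitably normalised eigenvectors, are smooth (\<open>smooth_eigenbasis\<close>).  If \<open>\<mu>\<^sub>j\<close> are the
  eigenvalues of \<open>B\<close>, then those of \<open>G\<close> are \<open>\<rho>\<^sub>j = 1 + h \<mu>\<^sub>j\<close>, with the same eigenvectors \<open>v\<^sub>j\<close>.

  The symplectic form satisfies \<open>(\<rho>\<^sub>i \<rho>\<^sub>j - 1) \<Omega>(v\<^sub>i, v\<^sub>j) = 0\<close>.  The first factor is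
  \<open>h (\<mu>\<^sub>i + \<mu>\<^sub>j + h \<mu>\<^sub>i \<mu>\<^sub>j)\<close>, which vanishes for small \<open>h \<noteq> 0\<close> at most when \<open>i\<close> and \<open>j\<close> belong to
  opposite frequencies, again by non-resonance.  Hence the eigenvectors form a symplectic basis
  up to scaling, and \<open>\<rho>\<^sub>i \<rho>\<^sub>j = 1\<close> for opposite frequencies, where \<open>\<Omega>(v\<^sub>i, v\<^sub>j)\<close> is close to
  \<open>\<plusminus>1\<close>.  Since the spectrum is invariant under conjugation, continuity forces
  \<open>\<rho>\<^sub>j\<close> to be the conjugate of \<open>\<rho>\<^sub>i\<close> for such a pair, so all multipliers lie on the unit circle.
  The frequency is then the imaginary part of \<open>Ln \<rho>\<^sub>k / h\<close>, which is smooth by another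
  division by \<open>h\<close>.

  The estimates come from reading the eigenvector equation row by row:
  \<open>(\<rho>\<^sub>j - exp (i h f\<^sub>i)) v\<^sub>i\<^sub>j\<close> is the entry of an \<open>O(h\<^sup>p\<^sup>+\<^sup>1)\<close> perturbation, where \<open>f\<close> lists the
  frequencies \<open>\<plusminus>\<omega>\<^sub>k\<close>, and for \<open>i \<noteq> j\<close> the factor is of exact order \<open>h\<close>; this loses one power
  (\<open>vanishes_of_nonresonant_perturbation\<close>).  Everything so far holds on an interval around
  \<open>0\<close>.  Precomposition with a smooth map of the real line into that interval which is the
  identity near \<open>0\<close> (\<open>smooth_cutoff\<close>) yields families defined for all \<open>h\<close>.
\<close>

section \<open>Smooth functions of one real variable\<close>

text \<open>
  Smoothness is treated through its finite stages, so that closure properties can be proved by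
  induction on the order.  Order \<open>0\<close> imposes nothing, not even continuity: only the conjunction
  over all orders is of interest, and order \<open>1\<close> already contains continuity.
\<close>

primrec kdiff :: "nat \<Rightarrow> real set \<Rightarrow> (real \<Rightarrow> 'a::real_normed_vector) \<Rightarrow> bool" where
  "kdiff 0 U f \<longleftrightarrow> True"
| "kdiff (Suc k) U f \<longleftrightarrow>
     (\<exists>f'. (\<forall>t\<in>U. (f has_vector_derivative f' t) (at t)) \<and> kdiff k U f')"

definition smooth_on :: "real set \<Rightarrow> (real \<Rightarrow> 'a::real_normed_vector) \<Rightarrow> bool" where
  "smooth_on U f \<longleftrightarrow> (\<forall>k. kdiff k U f)"

lemma kdiff_cong:
  assumes "open U" "\<And>t. t \<in> U \<Longrightarrow> f t = g t"
  shows "kdiff k U f \<longleftrightarrow> kdiff k U g"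
proof (cases k)
  case (Suc m)
  have "(f has_vector_derivative d) (at t) \<longleftrightarrow> (g has_vector_derivative d) (at t)"
    if "t \<in> U" for t d
    using has_vector_derivative_transform_within_open[OF _ assms(1) that] assms(2) by metis
  then show ?thesis by (simp add: Suc)
qed simp

lemma kdiff_SucD: "kdiff (Suc k) U f \<Longrightarrow> kdiff k U f"
proof (induction k arbitrary: f)
  case (Suc k)
  then show ?case by (metis kdiff.simps(2))
qed simp

lemma kdiff_SucI:
  "(\<And>t. t \<in> U \<Longrightarrow> (f has_vector_derivative f' t) (at t)) \<Longrightarrow> kdiff k U f' \<Longrightarrow> kdiff (Suc k) U f"
  by auto

lemma kdiff_mono_set: "kdiff k U f \<Longrightarrow> V \<subseteq> U \<Longrightarrow> kdiff k V f"
proof (induction k arbitrary: f)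
  case (Suc k)
  from Suc.prems(1) obtain f' where
    "\<forall>t\<in>U. (f has_vector_derivative f' t) (at t)" "kdiff k U f'" by auto
  with Suc.IH[of f'] Suc.prems(2) show ?case by (intro kdiff_SucI[of _ _ f']) auto
qed simp

lemma kdiff_const: "kdiff k U (\<lambda>t. c)"
proof (induction k arbitrary: c)
  case (Suc k)
  show ?case by (rule kdiff_SucI[OF _ Suc[of 0]]) simp
qed simp

lemma kdiff_ident: "kdiff k U (\<lambda>t::real. t)"
proof (cases k)
  case (Suc m)
  show ?thesis unfolding Suc by (rule kdiff_SucI[OF _ kdiff_const[of _ _ 1]]) simp
qed simp

lemma kdiff_add: "kdiff k U f \<Longrightarrow> kdiff k U g \<Longrightarrow> kdiff k U (\<lambda>t. f t + g t)"
proof (induction k arbitrary: f g)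
  case (Suc k)
  then obtain f' g' where
    "\<forall>t\<in>U. (f has_vector_derivative f' t) (at t)" "kdiff k U f'"
    "\<forall>t\<in>U. (g has_vector_derivative g' t) (at t)" "kdiff k U g'" by auto
  with Suc.IH show ?case
    by (intro kdiff_SucI[of _ _ "\<lambda>t. f' t + g' t"]) (auto intro: has_vector_derivative_add)
qed simp

lemma kdiff_bounded_linear:
  assumes "bounded_linear L"
  shows "kdiff k U f \<Longrightarrow> kdiff k U (\<lambda>t. L (f t))"
proof (induction k arbitrary: f)
  case (Suc k)
  then obtain f' where
    "\<forall>t\<in>U. (f has_vector_derivative f' t) (at t)" "kdiff k U f'" by auto
  with Suc.IH show ?case
    by (intro kdiff_SucI[of _ _ "\<lambda>t. L (f' t)"])
       (auto intro: bounded_linear.has_vector_derivative[OF assms])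
qed simp

text \<open>The induction needs both factors \<open>k\<close> times differentiable as soon as they are \<open>k + 1\<close> times
  differentiable, because the Leibniz rule mixes a function with the derivative of the other.\<close>

lemma kdiff_bilinear:
  assumes "bounded_bilinear b"
  shows "kdiff k U f \<Longrightarrow> kdiff k U g \<Longrightarrow> kdiff k U (\<lambda>t. b (f t) (g t))"
proof (induction k arbitrary: f g)
  case (Suc k)
  then obtain f' g' where *:
    "\<forall>t\<in>U. (f has_vector_derivative f' t) (at t)" "kdiff k U f'"
    "\<forall>t\<in>U. (g has_vector_derivative g' t) (at t)" "kdiff k U g'" by auto
  show ?case
    by (rule kdiff_SucI[of _ _ "\<lambda>t. b (f t) (g' t) + b (f' t) (g t)"])
       (use * in \<open>auto intro!: bounded_bilinear.has_vector_derivative[OF assms] kdiff_add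
          Suc.IH kdiff_SucD[OF Suc.prems(1)] kdiff_SucD[OF Suc.prems(2)]\<close>)
qed simp

lemmas kdiff_mult = kdiff_bilinear[OF bounded_bilinear_mult]
  and kdiff_scaleR = kdiff_bilinear[OF bounded_bilinear_scaleR]

lemma kdiff_uminus: "kdiff k U f \<Longrightarrow> kdiff k U (\<lambda>t. - f t)"
  by (rule kdiff_bounded_linear[OF bounded_linear_minus[OF bounded_linear_ident]])

lemma kdiff_diff: "kdiff k U f \<Longrightarrow> kdiff k U g \<Longrightarrow> kdiff k U (\<lambda>t. f t - g t)"
  using kdiff_add[of k U f "\<lambda>t. - g t"] kdiff_uminus[of k U g] by simp

lemma kdiff_sum: "(\<And>i. i \<in> I \<Longrightarrow> kdiff k U (f i)) \<Longrightarrow> kdiff k U (\<lambda>t. \<Sum>i\<in>I. f i t)"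
  by (induction I rule: infinite_finite_induct) (auto intro: kdiff_const kdiff_add)

lemma kdiff_prod:
  fixes f :: "'i \<Rightarrow> real \<Rightarrow> 'a::real_normed_field"
  shows "(\<And>i. i \<in> I \<Longrightarrow> kdiff k U (f i)) \<Longrightarrow> kdiff k U (\<lambda>t. \<Prod>i\<in>I. f i t)"
  by (induction I rule: infinite_finite_induct) (auto intro: kdiff_const kdiff_mult)

lemma kdiff_power:
  fixes f :: "real \<Rightarrow> 'a::real_normed_field"
  shows "kdiff k U f \<Longrightarrow> kdiff k U (\<lambda>t. f t ^ n)"
  by (induction n) (auto intro: kdiff_const kdiff_mult)

text \<open>Bootstrapping: a function solving a differential equation whose right-hand side is as regular
  as the solution is smooth.  This is how quotients, logarithms and implicitly defined functions
  are treated.\<close>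

lemma smooth_on_bootstrap:
  assumes "\<And>t. t \<in> U \<Longrightarrow> (f has_vector_derivative f' t) (at t)"
    and "\<And>k. kdiff k U f \<Longrightarrow> kdiff k U f'"
  shows "smooth_on U f"
proof -
  have "kdiff k U f" for k
  proof (induction k)
    case (Suc k)
    then show ?case using assms by (intro kdiff_SucI[of _ _ f']) auto
  qed simp
  then show ?thesis by (simp add: smooth_on_def)
qed

lemma smooth_on_kdiff: "smooth_on U f \<Longrightarrow> kdiff k U f"
  by (simp add: smooth_on_def)

text \<open>
  The derivatives witnessing \<open>kdiff\<close> may a priori change with the order; on an open set they are
  all equal to the one derivative, which is therefore smooth itself.
\<close>

lemma smooth_onE:
  assumes "smooth_on U f" "open U"
  obtains f' where "\<And>t. t \<in> U \<Longrightarrow> (f has_vector_derivative f' t) (at t)" "smooth_on U f'"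
proof -
  define f' where "f' t = vector_derivative f (at t)" for t
  have d: "(f has_vector_derivative g t) (at t) \<Longrightarrow> g t = f' t" for g t
    unfolding f'_def by (simp add: vector_derivative_at)
  have 1: "(f has_vector_derivative f' t) (at t)" if "t \<in> U" for t
    using smooth_on_kdiff[OF assms(1), of 1] that d by auto
  have "kdiff k U f'" for k
  proof -
    obtain g where g: "\<forall>t\<in>U. (f has_vector_derivative g t) (at t)" "kdiff k U g"
      using smooth_on_kdiff[OF assms(1), of "Suc k"] by auto
    then show ?thesis using kdiff_cong[OF assms(2), of g f'] d by blast
  qed
  with 1 that show ?thesis by (auto simp: smooth_on_def)
qed

lemma kdiff_inverse:
  fixes f :: "real \<Rightarrow> 'a::real_normed_field"
  shows "kdiff k U f \<Longrightarrow> (\<And>t. t \<in> U \<Longrightarrow> f t \<noteq> 0) \<Longrightarrow> kdiff k U (\<lambda>t. inverse (f t))"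
proof (induction k)
  case (Suc k)
  from Suc.prems(1) obtain f' where
    f': "\<forall>t\<in>U. (f has_vector_derivative f' t) (at t)" "kdiff k U f'" by auto
  have inv: "kdiff k U (\<lambda>t. inverse (f t))"
    using Suc.IH[OF kdiff_SucD[OF Suc.prems(1)] Suc.prems(2)] .
  show ?case
  proof (rule kdiff_SucI)
    fix t assume t: "t \<in> U"
    have "((inverse \<circ> f) has_vector_derivative f' t * - (inverse (f t) * inverse (f t))) (at t)"
      by (rule field_vector_diff_chain_at[OF bspec[OF f'(1) t]])
         (use DERIV_inverse[OF Suc.prems(2)[OF t]] in \<open>simp add: power2_eq_square\<close>)
    then show "((\<lambda>t. inverse (f t)) has_vector_derivative f' t * - (inverse (f t) * inverse (f t))) (at t)"
      by (simp add: o_def)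
  next
    show "kdiff k U (\<lambda>t. f' t * - (inverse (f t) * inverse (f t)))"
      by (intro kdiff_mult kdiff_uminus f'(2) inv)
  qed
qed simp

lemma smooth_on_compose:
  fixes \<phi> :: "real \<Rightarrow> real" and f :: "real \<Rightarrow> 'a::real_normed_vector"
  assumes f: "smooth_on V f" "open V" and \<phi>: "smooth_on U \<phi>" "open U" "\<phi> ` U \<subseteq> V"
  shows "smooth_on U (\<lambda>t. f (\<phi> t))"
proof -
  obtain \<phi>' where \<phi>': "\<And>t. t \<in> U \<Longrightarrow> (\<phi> has_vector_derivative \<phi>' t) (at t)" "smooth_on U \<phi>'"
    using smooth_onE[OF \<phi>(1,2)] by blast
  have "kdiff k U (\<lambda>t. f (\<phi> t))" if "smooth_on V f" for k and f :: "real \<Rightarrow> 'a"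
    using that
  proof (induction k arbitrary: f)
    case (Suc k)
    obtain f' where f': "\<And>t. t \<in> V \<Longrightarrow> (f has_vector_derivative f' t) (at t)" "smooth_on V f'"
      using smooth_onE[OF Suc.prems f(2)] by blast
    show ?case
    proof (rule kdiff_SucI)
      fix t assume "t \<in> U"
      then show "((\<lambda>t. f (\<phi> t)) has_vector_derivative \<phi>' t *\<^sub>R f' (\<phi> t)) (at t)"
        using vector_diff_chain_at[OF \<phi>'(1) f'(1)] \<phi>(3) by (auto simp: o_def)
    next
      show "kdiff k U (\<lambda>t. \<phi>' t *\<^sub>R f' (\<phi> t))"
        by (rule kdiff_scaleR[OF smooth_on_kdiff[OF \<phi>'(2)] Suc.IH[OF f'(2)]])
    qed
  qed simp
  from this[OF f(1)] show ?thesis by (simp add: smooth_on_def)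
qed

lemma smooth_on_subset: "smooth_on U f \<Longrightarrow> V \<subseteq> U \<Longrightarrow> smooth_on V f"
  by (auto simp: smooth_on_def intro: kdiff_mono_set)

lemma smooth_on_imp_isCont: "smooth_on U f \<Longrightarrow> t \<in> U \<Longrightarrow> isCont f t"
  using smooth_on_kdiff[of U f 1] by (auto intro: has_vector_derivative_continuous)

named_theorems smooth_intros

lemma [smooth_intros]:
  shows smooth_on_const: "smooth_on U (\<lambda>t. c)"
    and smooth_on_ident: "smooth_on U (\<lambda>t::real. t)"
    and smooth_on_add: "smooth_on U f \<Longrightarrow> smooth_on U g \<Longrightarrow> smooth_on U (\<lambda>t. f t + g t)"
    and smooth_on_diff: "smooth_on U f \<Longrightarrow> smooth_on U g \<Longrightarrow> smooth_on U (\<lambda>t. f t - g t)"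
    and smooth_on_uminus: "smooth_on U f \<Longrightarrow> smooth_on U (\<lambda>t. - f t)"
    and smooth_on_scaleR: "smooth_on U a \<Longrightarrow> smooth_on U f \<Longrightarrow> smooth_on U (\<lambda>t. a t *\<^sub>R f t)"
    and smooth_on_sum: "(\<And>i. i \<in> I \<Longrightarrow> smooth_on U (F i)) \<Longrightarrow> smooth_on U (\<lambda>t. \<Sum>i\<in>I. F i t)"
  by (simp_all add: smooth_on_def kdiff_const kdiff_ident kdiff_add kdiff_diff kdiff_uminus
      kdiff_scaleR kdiff_sum)

lemma [smooth_intros]:
  fixes f g :: "real \<Rightarrow> 'a::real_normed_field"
  shows smooth_on_mult: "smooth_on U f \<Longrightarrow> smooth_on U g \<Longrightarrow> smooth_on U (\<lambda>t. f t * g t)"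
    and smooth_on_prod: "(\<And>i. i \<in> I \<Longrightarrow> smooth_on U (F i)) \<Longrightarrow> smooth_on U (\<lambda>t. \<Prod>i\<in>I. F i t :: 'a)"
    and smooth_on_power: "smooth_on U f \<Longrightarrow> smooth_on U (\<lambda>t. f t ^ n)"
  by (simp_all add: smooth_on_def kdiff_mult kdiff_prod kdiff_power)

lemma smooth_on_divide [smooth_intros]:
  fixes f g :: "real \<Rightarrow> 'a::real_normed_field"
  assumes "smooth_on U f" "smooth_on U g" "\<And>t. t \<in> U \<Longrightarrow> g t \<noteq> 0"
  shows "smooth_on U (\<lambda>t. f t / g t)"
  using assms by (simp add: smooth_on_def divide_inverse kdiff_mult kdiff_inverse)

lemma smooth_on_bounded_linear:
  "bounded_linear L \<Longrightarrow> smooth_on U f \<Longrightarrow> smooth_on U (\<lambda>t. L (f t))"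
  by (simp add: smooth_on_def kdiff_bounded_linear)

lemma smooth_on_vec_nth [smooth_intros]: "smooth_on U f \<Longrightarrow> smooth_on U (\<lambda>t. f t $ i)"
  by (rule smooth_on_bounded_linear[OF bounded_linear_vec_nth])

lemma smooth_on_vec_lambda [smooth_intros]:
  fixes f :: "'m::finite \<Rightarrow> real \<Rightarrow> 'a::real_normed_vector"
  assumes "\<And>i. smooth_on U (f i)"
  shows "smooth_on U (\<lambda>t. \<chi> i. f i t)"
proof -
  let ?e = "\<lambda>(i::'m) (x::'a). (\<chi> j. if j = i then x else 0)"
  have L: "bounded_linear (?e i)" for i
  proof (rule bounded_linear_intro[where K=1])
    show "norm (?e i x) \<le> norm x * 1" for x :: 'a
    proof -
      have "norm (?e i x) \<le> (\<Sum>j\<in>UNIV. norm (?e i x $ j))"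
        unfolding norm_vec_def by (rule L2_set_le_sum) simp
      also have "\<dots> = (\<Sum>j\<in>UNIV. if j = i then norm x else 0)"
        by (intro sum.cong) auto
      finally show ?thesis by simp
    qed
  qed (auto simp: vec_eq_iff)
  have eq: "(\<chi> i. f i t) = (\<Sum>i\<in>UNIV. ?e i (f i t))" for t
    by (simp add: vec_eq_iff)
  show ?thesis unfolding eq by (intro smooth_on_sum smooth_on_bounded_linear[OF L] assms)
qed

lemma smooth_on_det [smooth_intros]:
  fixes A :: "real \<Rightarrow> 'a::real_normed_field ^ 'm::finite ^ 'm"
  assumes "\<And>i j. smooth_on U (\<lambda>t. A t $ i $ j)"
  shows "smooth_on U (\<lambda>t. det (A t))"
  unfolding det_def by (intro smooth_intros assms)

lemma smooth_on_matrix_mult [smooth_intros]: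
  fixes A :: "real \<Rightarrow> 'a::real_normed_field ^ 'm::finite ^ 'l::finite" and B :: "real \<Rightarrow> 'a ^ 'n::finite ^ 'm"
  assumes "smooth_on U A" "smooth_on U B"
  shows "smooth_on U (\<lambda>t. A t ** B t)"
  unfolding matrix_matrix_mult_def by (intro smooth_intros assms)

lemma smooth_on_transpose [smooth_intros]:
  fixes A :: "real \<Rightarrow> 'a::real_normed_vector ^ 'm::finite ^ 'l::finite"
  assumes "smooth_on U A"
  shows "smooth_on U (\<lambda>t. transpose (A t))"
  unfolding transpose_def by (intro smooth_intros assms)

text \<open>
  The link with iterated total derivatives, which take arbitrary values where a function is not
  differentiable.
\<close>

lemma smooth_iff_smooth_on: "smooth f \<longleftrightarrow> smooth_on UNIV f"
proof
  assume s: "smooth f"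
  let ?D = "\<lambda>g s. vector_derivative g (at s)"
  have "kdiff k UNIV ((?D ^^ m) f)" for k m
  proof (induction k arbitrary: m)
    case (Suc k)
    show ?case
    proof (rule kdiff_SucI)
      show "kdiff k UNIV ((?D ^^ Suc m) f)" by (rule Suc)
      show "((?D ^^ m) f has_vector_derivative (?D ^^ Suc m) f t) (at t)" for t
        using s by (simp add: smooth_def vector_derivative_works)
    qed
  qed simp
  from this[of _ 0] show "smooth_on UNIV f" by (simp add: smooth_on_def)
next
  assume s: "smooth_on UNIV f"
  let ?D = "\<lambda>g s. vector_derivative g (at s)"
  have 1: "smooth_on UNIV (?D g)" if g: "smooth_on UNIV g" for g :: "real \<Rightarrow> 'a"
  proof -
    obtain g' where "\<And>t. (g has_vector_derivative g' t) (at t)" "smooth_on UNIV g'"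
      using smooth_onE[OF g] by auto
    moreover from this have "?D g = g'" by (auto simp: vector_derivative_at)
    ultimately show ?thesis by simp
  qed
  have "smooth_on UNIV ((?D ^^ k) f)" for k
    by (induction k) (use s in \<open>auto intro!: 1\<close>)
  then show "smooth f"
    unfolding smooth_def using smooth_on_kdiff[of UNIV _ 1]
    by (fastforce intro: differentiableI_vector)
qed

lemma smooth_on_eventually_nonzero:
  fixes f :: "real \<Rightarrow> 'a::real_normed_vector"
  assumes "smooth_on U f" "0 \<in> U" "f 0 \<noteq> 0"
  shows "\<forall>\<^sub>F h in nhds 0. f h \<noteq> 0"
proof (rule tendsto_imp_eventually_ne)
  show "(f \<longlongrightarrow> f 0) (nhds 0)"
    using smooth_on_imp_isCont[OF assms(1,2)] by (simp add: isCont_def tendsto_at_iff_tendsto_nhds)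
qed (rule assms(3))

lemma smooth_on_tendsto:
  assumes "smooth_on U f" "0 \<in> U"
  shows "(f \<longlongrightarrow> f 0) (at 0)"
  using smooth_on_imp_isCont[OF assms] by (simp add: isCont_def)

lemma smooth_on_Ln:
  assumes f: "smooth_on U f" "open U" and pos: "\<And>t. t \<in> U \<Longrightarrow> f t \<notin> \<real>\<^sub>\<le>\<^sub>0"
  shows "smooth_on U (\<lambda>t. Ln (f t))"
proof -
  obtain f' where f': "\<And>t. t \<in> U \<Longrightarrow> (f has_vector_derivative f' t) (at t)" "smooth_on U f'"
    using smooth_onE[OF f] by blast
  have nz: "f t \<noteq> 0" if "t \<in> U" for t using pos[OF that] by auto
  show ?thesis
  proof (rule smooth_on_bootstrap)
    fix t assume t: "t \<in> U"
    show "((\<lambda>t. Ln (f t)) has_vector_derivative f' t / f t) (at t)"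
      using field_vector_diff_chain_at[OF f'(1)[OF t] has_field_derivative_Ln[OF pos[OF t]]]
      by (simp add: o_def divide_inverse)
  next
    fix k
    \<comment> \<open>The derivative does not involve the logarithm, so the bootstrap closes at once.\<close>
    show "kdiff k U (\<lambda>t. f' t / f t)"
      by (rule smooth_on_kdiff[OF smooth_on_divide[OF f'(2) f(1) nz]])
  qed
qed

section \<open>A smooth cut-off\<close>

text \<open>
  \<open>flat 0\<close> is the standard smooth function that vanishes to infinite order at \<open>0\<close>.  The negative
  powers are included because the span of the whole family is closed under differentiation.
\<close>

definition flat :: "nat \<Rightarrow> real \<Rightarrow> real" where
  "flat n x = (if x \<le> 0 then 0 else inverse x ^ n * exp (- inverse x))"

lemma tendsto_flat_0: "(flat n \<longlongrightarrow> 0) (at_right 0)"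
proof -
  have "((\<lambda>y. y ^ n / exp y) \<longlongrightarrow> 0) (at_top :: real filter)"
    by (rule tendsto_power_div_exp_0)
  then have "((\<lambda>x. inverse x ^ n / exp (inverse x)) \<longlongrightarrow> (0::real)) (at_right 0)"
    by (rule filterlim_compose[OF _ filterlim_inverse_at_top_right])
  moreover have "\<forall>\<^sub>F x in at_right 0. inverse x ^ n / exp (inverse x) = flat n x"
    by (auto simp: eventually_at_right_field flat_def exp_minus divide_inverse intro!: exI[of _ 1])
  ultimately show ?thesis by (rule Lim_transform_eventually)
qed

lemma flat_has_derivative:
  "(flat n has_vector_derivative flat (n + 2) x - n * flat (n + 1) x) (at x)"
proof -
  consider "x < 0" | "x = 0" | "x > 0" by linarith
  then show ?thesis
  proof cases
    case 1
    then have z: "flat (n + 2) x - n * flat (n + 1) x = 0" by (simp add: flat_def)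
    show ?thesis unfolding z
      by (rule has_vector_derivative_transform_within_open[of "\<lambda>_. 0" _ _ "{..<0}"])
         (use 1 in \<open>auto simp: flat_def\<close>)
  next
    case 2
    have "((\<lambda>h. flat n h / h) \<longlongrightarrow> 0) (at 0)"
    proof (subst filterlim_split_at)
      show "((\<lambda>h. flat n h / h) \<longlongrightarrow> 0) (at_left 0)"
        by (rule tendsto_eventually) (auto simp: eventually_at_left_field flat_def intro!: exI[of _ "-1"])
      show "((\<lambda>h. flat n h / h) \<longlongrightarrow> 0) (at_right 0)"
        by (rule Lim_transform_eventually[OF tendsto_flat_0[of "Suc n"]])
           (auto simp: eventually_at_right_field flat_def divide_inverse intro!: exI[of _ 1])
    qed simp
    moreover have "flat n 0 = 0" by (simp add: flat_def)
    ultimately have "(flat n has_field_derivative 0) (at 0)"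
      by (simp add: DERIV_def)
    then show ?thesis
      by (simp add: 2 flat_def has_real_derivative_iff_has_vector_derivative)
  next
    case 3
    have "((\<lambda>x. inverse x ^ n) has_field_derivative - n * inverse x ^ (n + 1)) (at x)"
    proof (cases n)
      case (Suc m)
      have "((\<lambda>x. inverse x ^ Suc m) has_field_derivative
          (1 + of_nat m) * (- (inverse x ^ Suc (Suc 0)) * inverse x ^ m)) (at x)"
        by (rule DERIV_power_Suc[OF DERIV_inverse]) (use 3 in simp)
      then show ?thesis by (simp add: Suc algebra_simps)
    qed simp
    moreover have "((\<lambda>x. exp (- inverse x)) has_field_derivative
        exp (- inverse x) * inverse x ^ 2) (at x)"
      using 3 by (auto intro!: derivative_eq_intros simp: power2_eq_square)
    ultimately have "((\<lambda>x. inverse x ^ n * exp (- inverse x)) has_field_derivative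
        - n * inverse x ^ (n + 1) * exp (- inverse x)
          + exp (- inverse x) * inverse x ^ 2 * inverse x ^ n) (at x)"
      by (rule DERIV_mult)
    then have "((\<lambda>x. inverse x ^ n * exp (- inverse x)) has_field_derivative
            flat (n + 2) x - n * flat (n + 1) x) (at x)"
      using 3 by (simp add: flat_def algebra_simps power_add power2_eq_square)
    then have "((\<lambda>x. inverse x ^ n * exp (- inverse x)) has_vector_derivative
            flat (n + 2) x - n * flat (n + 1) x) (at x)"
      by (simp add: has_real_derivative_iff_has_vector_derivative)
    then show ?thesis
      by (rule has_vector_derivative_transform_within_open[of _ _ _ "{0<..}"])
         (use 3 in \<open>auto simp: flat_def\<close>)
  qed
qed

lemma smooth_on_flat: "smooth_on UNIV (flat n)"
proof -
  have "kdiff k UNIV (flat n)" for k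
  proof (induction k arbitrary: n)
    case (Suc k)
    show ?case
      by (rule kdiff_SucI[OF flat_has_derivative])
         (intro kdiff_diff kdiff_mult kdiff_const Suc.IH)
  qed simp
  then show ?thesis by (simp add: smooth_on_def)
qed

text \<open>
  Up to scaling the map is \<open>t / (1 + t\<^sup>2 flat 0 (t\<^sup>2 - 1))\<close>.  The denominator is \<open>1\<close> for
  \<open>\<bar>t\<bar> \<le> 1\<close> and grows quadratically, so the map is bounded.  A function defined on an interval
  around \<open>0\<close> is extended to the whole line, without being changed near \<open>0\<close>, by composing with
  such a map.  Unlike multiplication by a bump function this respects nonlinear constraints such
  as being symplectic.
\<close>

lemma smooth_cutoff:
  fixes \<delta> :: real
  assumes "\<delta> > 0"
  obtains \<psi> :: "real \<Rightarrow> real" where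
    "smooth_on UNIV \<psi>" "\<And>h. \<bar>\<psi> h\<bar> < \<delta>" "\<forall>\<^sub>F h in nhds 0. \<psi> h = h"
proof -
  \<comment> \<open>The unscaled map is bounded by \<open>2\<close>, and \<open>2 \<delta> / 3 < \<delta>\<close>.\<close>
  define a where "a = \<delta> / 3"
  have a: "a > 0" using assms by (simp add: a_def)
  define D where "D t = 1 + t\<^sup>2 * flat 0 (t\<^sup>2 - 1)" for t :: real
  have D1: "D t \<ge> 1" for t by (auto simp: D_def flat_def)
  have Dpos: "D t > 0" for t using D1[of t] by linarith
  have D0: "D t \<noteq> 0" for t using Dpos[of t] by simp
  have bound: "\<bar>t / D t\<bar> \<le> 2" for t
  proof (cases "\<bar>t\<bar> \<le> 2")
    case True
    have "\<bar>t\<bar> / D t \<le> \<bar>t\<bar> / 1" by (rule divide_left_mono) (use D1[of t] in auto)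
    with True Dpos[of t] show ?thesis by simp
  next
    case False
    have "2\<^sup>2 \<le> \<bar>t\<bar>\<^sup>2" by (rule power_mono) (use False in auto)
    then have t4: "t\<^sup>2 \<ge> 4" by simp
    have "exp (- 1) \<le> exp (- inverse (t\<^sup>2 - 1))"
      using t4 by (simp add: field_simps)
    then have "exp (- 1) \<le> flat 0 (t\<^sup>2 - 1)" using t4 by (simp add: flat_def)
    moreover have "(1::real) / 3 \<le> exp (- 1)"
      using exp_le by (simp add: exp_minus field_simps)
    ultimately have "1 / 3 \<le> flat 0 (t\<^sup>2 - 1)" by linarith
    then have "t\<^sup>2 * (1 / 3) \<le> t\<^sup>2 * flat 0 (t\<^sup>2 - 1)" by (rule mult_left_mono) simp
    then have D: "1 + t\<^sup>2 / 3 \<le> D t" by (simp add: D_def)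
    \<comment> \<open>Completing a square bounds a linear function by the quadratic lower bound of the denominator.\<close>
    have "0 \<le> (2 * \<bar>t\<bar> - 3/2)\<^sup>2" by simp
    then have "\<bar>t\<bar> \<le> 2 * (1 + t\<^sup>2 / 3)"
      by (simp add: power2_eq_square algebra_simps)
    also have "\<dots> \<le> 2 * D t" by (rule mult_left_mono[OF D]) simp
    finally show ?thesis
      by (simp only: abs_divide abs_of_pos[OF Dpos[of t]] pos_divide_le_eq[OF Dpos[of t]])
  qed
  define \<psi> where "\<psi> h = a * (h / a / D (h / a))" for h
  have sm: "smooth_on UNIV (\<lambda>t. flat 0 (f t))" if "smooth_on UNIV f" for f
    by (rule smooth_on_compose[OF smooth_on_flat _ that]) auto
  have "smooth_on UNIV \<psi>"
    unfolding \<psi>_def[abs_def] using D0 a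
    by (auto intro!: smooth_intros) (auto simp: D_def intro!: smooth_intros sm)
  moreover have "\<bar>\<psi> h\<bar> < \<delta>" for h
  proof -
    have "\<bar>\<psi> h\<bar> = a * \<bar>h / a / D (h / a)\<bar>" unfolding \<psi>_def using a by (simp add: abs_mult)
    also have "\<dots> \<le> a * 2" using bound[of "h / a"] a by (intro mult_left_mono) auto
    finally show ?thesis using a by (simp add: a_def)
  qed
  moreover have "\<forall>\<^sub>F h in nhds 0. \<psi> h = h"
  proof -
    have "\<psi> h = h" if "dist h 0 < a" for h
    proof -
      have "\<bar>h / a\<bar> \<le> 1" using that a by (simp add: field_simps)
      then have "(h / a)\<^sup>2 \<le> 1" by (simp only: abs_square_le_1)
      then have "D (h / a) = 1" by (simp add: D_def flat_def)
      then show ?thesis using a by (simp add: \<psi>_def)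
    qed
    then show ?thesis using a by (auto simp: eventually_nhds_metric)
  qed
  ultimately show ?thesis by (rule that)
qed

section \<open>Division of a smooth function by its variable\<close>

text \<open>
  The quotient is \<open>\<integral>\<^sub>0\<^sup>1 f' (t h) dt\<close>.  Differentiating it under the integral sign produces a
  factor \<open>t\<close>, so the induction runs over all moments \<open>\<integral>\<^sub>0\<^sup>1 t\<^sup>m \<phi> (t h) dt\<close> at once.
\<close>

lemma hadamard_division:
  fixes f :: "real \<Rightarrow> 'a::euclidean_space"
  assumes f: "smooth_on U f" and U: "open U" "convex U" "0 \<in> U" and f0: "f 0 = 0"
  obtains g where "smooth_on U g" "\<And>h. h \<in> U \<Longrightarrow> f h = h *\<^sub>R g h"
proof -
  obtain f' where f': "\<And>t. t \<in> U \<Longrightarrow> (f has_vector_derivative f' t) (at t)" "smooth_on U f'"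
    using smooth_onE[OF f U(1)] by blast
  define I where "I \<phi> m h = integral (cbox 0 1) (\<lambda>t. t ^ m *\<^sub>R \<phi> (t * h))"
    for \<phi> :: "real \<Rightarrow> 'a" and m :: nat and h :: real
  have th: "t * h \<in> U" if "h \<in> U" "t \<in> cbox 0 1" for t h :: real
    using convexD[OF U(2) that(1) U(3), of t "1 - t"] that(2) by simp
  have cont: "continuous_on U \<phi>" if "smooth_on U \<phi>" for \<phi> :: "real \<Rightarrow> 'a"
    using smooth_on_imp_isCont[OF that] continuous_at_imp_continuous_on by blast
  have cont2: "continuous_on (U \<times> cbox 0 1) (\<lambda>(h, t). t ^ m *\<^sub>R \<phi> (t * h))"
    if "smooth_on U \<phi>" for \<phi> :: "real \<Rightarrow> 'a" and m
    unfolding case_prod_unfold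
    by (intro continuous_intros continuous_on_compose2[OF cont[OF that]]) (auto intro!: th)
  have int: "(\<lambda>t. t ^ m *\<^sub>R \<phi> (t * h)) integrable_on cbox 0 1"
    if "smooth_on U \<phi>" "h \<in> U" for \<phi> :: "real \<Rightarrow> 'a" and m h
    by (intro integrable_continuous continuous_intros continuous_on_compose2[OF cont[OF that(1)]])
       (use that(2) th in auto)
  have "kdiff k U (I \<phi> m)" if "smooth_on U \<phi>" for k m \<phi>
    using that
  proof (induction k arbitrary: m \<phi>)
    case (Suc k)
    obtain \<phi>' where \<phi>': "\<And>t. t \<in> U \<Longrightarrow> (\<phi> has_vector_derivative \<phi>' t) (at t)" "smooth_on U \<phi>'"
      using smooth_onE[OF Suc.prems U(1)] by blast
    show ?case
    proof (rule kdiff_SucI)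
      fix h assume h: "h \<in> U"
      have "((\<lambda>h. integral (cbox 0 1) (\<lambda>t. t ^ m *\<^sub>R \<phi> (t * h))) has_vector_derivative
          integral (cbox 0 1) (\<lambda>t. t ^ Suc m *\<^sub>R \<phi>' (t * h))) (at h within U)"
      proof (rule leibniz_rule_vector_derivative[where fx = "\<lambda>h t. t ^ Suc m *\<^sub>R \<phi>' (t * h)"])
        fix x t :: real assume x: "x \<in> U" "t \<in> cbox 0 1"
        have "((\<lambda>x. t * x) has_vector_derivative t) (at x)"
          by (auto intro!: derivative_eq_intros)
        from vector_diff_chain_at[OF this \<phi>'(1)[OF th[OF x]]]
        have "((\<lambda>x. \<phi> (t * x)) has_vector_derivative t *\<^sub>R \<phi>' (t * x)) (at x)"
          by (simp add: o_def)
        from bounded_linear.has_vector_derivative[OF bounded_linear_scaleR_right this, of "t ^ m"]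
        show "((\<lambda>x. t ^ m *\<^sub>R \<phi> (t * x)) has_vector_derivative t ^ Suc m *\<^sub>R \<phi>' (t * x)) (at x within U)"
          by (simp add: mult.commute has_vector_derivative_at_within)
      qed (use h U int[OF Suc.prems] cont2[OF \<phi>'(2), of "Suc m"] in \<open>simp_all del: power_Suc\<close>)
      then show "(I \<phi> m has_vector_derivative I \<phi>' (Suc m) h) (at h)"
        unfolding I_def[abs_def] at_within_open[OF h U(1)] .
    qed (rule Suc.IH[OF \<phi>'(2)])
  qed simp
  then have "smooth_on U (I f' 0)" using f'(2) by (simp add: smooth_on_def)
  moreover have "f h = h *\<^sub>R I f' 0 h" if h: "h \<in> U" for h
  proof -
    have "((\<lambda>t. h *\<^sub>R f' (t * h)) has_integral (f (1 * h) - f (0 * h))) {0..1}"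
    proof (rule fundamental_theorem_of_calculus)
      fix t :: real assume t: "t \<in> {0..1}"
      have "((\<lambda>x. x * h) has_vector_derivative h) (at t within {0..1})"
        by (auto intro!: derivative_eq_intros)
      moreover have "(f has_vector_derivative f' (t * h)) (at (t * h) within ((\<lambda>x. x * h) ` {0..1}))"
        using f'(1) th[OF h] t by (auto intro: has_vector_derivative_at_within)
      ultimately show "((\<lambda>x. f (x * h)) has_vector_derivative h *\<^sub>R f' (t * h)) (at t within {0..1})"
        using vector_diff_chain_within[of "\<lambda>x. x * h" h t "{0..1}" f "f' (t * h)"]
        unfolding o_def by blast
    qed simp
    then have "integral {0..1} (\<lambda>t. h *\<^sub>R f' (t * h)) = f h"
      using f0 by (intro integral_unique) simp
    moreover have "I f' 0 h = integral {0..1} (\<lambda>t. f' (t * h))" by (simp add: I_def)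
    ultimately show ?thesis by (simp only: integral_cmul)
  qed
  ultimately show ?thesis by (rule that[of "I f' 0"])
qed

section \<open>Simple roots of a smooth family of polynomials\<close>

text \<open>
  This is \<open>\<bar>p'(z) / p(z)\<bar> = \<bar>\<Sum> 1 / (z - r)\<bar> \<le> n / \<rho>\<close>, the sum over the \<open>n\<close> roots \<open>r\<close>, multiplied
  out so that \<open>p(z) = 0\<close> is permitted.  The induction removes one linear factor at a time.
\<close>

lemma poly_pderiv_bound:
  fixes p :: "complex poly"
  assumes "\<rho> \<ge> 0" "\<And>x. poly p x = 0 \<Longrightarrow> \<rho> \<le> norm (z - x)"
  shows "\<rho> * norm (poly (pderiv p) z) \<le> degree p * norm (poly p z)"
  using assms(2)
proof (induction "degree p" arbitrary: p)
  case 0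
  then have "pderiv p = 0" by (simp add: pderiv_eq_0_iff)
  then show ?case by simp
next
  case (Suc n)
  from Suc.hyps(2) obtain r where r: "poly p r = 0"
    using fundamental_theorem_of_algebra[of p] constant_degree[of p] by auto
  then obtain s where s: "p = [:- r, 1:] * s" by (metis dvdE poly_eq_0_iff_dvd)
  with Suc.hyps(2) have "s \<noteq> 0" by auto
  then have ds: "degree p = Suc (degree s)" by (simp add: s degree_mult_eq del: mult_pCons_left)
  have "poly p z = (z - r) * poly s z" unfolding s poly_mult by simp
  then have pz: "norm (poly p z) = norm (z - r) * norm (poly s z)" by (simp add: norm_mult)
  have IH: "\<rho> * norm (poly (pderiv s) z) \<le> degree s * norm (poly s z)"
    using Suc.hyps(1)[of s] Suc.hyps(2) ds Suc.prems by (simp add: s)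
  have "poly (pderiv p) z = poly s z + (z - r) * poly (pderiv s) z"
    unfolding s pderiv_mult by (simp add: pderiv_pCons algebra_simps)
  then have "\<rho> * norm (poly (pderiv p) z)
      \<le> \<rho> * (norm (poly s z) + norm (z - r) * norm (poly (pderiv s) z))"
    using assms(1) by (metis mult_left_mono norm_mult norm_triangle_ineq)
  also have "\<dots> = \<rho> * norm (poly s z) + norm (z - r) * (\<rho> * norm (poly (pderiv s) z))"
    by (simp add: algebra_simps)
  also have "\<dots> \<le> norm (z - r) * norm (poly s z) + norm (z - r) * (degree s * norm (poly s z))"
    by (intro add_mono mult_right_mono mult_left_mono Suc.prems r IH) auto
  also have "\<dots> = degree p * norm (poly p z)"
    unfolding ds pz by (simp add: algebra_simps)
  finally show ?case .
qed

text \<open>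
  If every root were farther away, the logarithmic derivative at \<open>z\<close> would be too small.  The bound
  involves neither the leading coefficient nor the other roots, so it is uniform in a family of
  polynomials of bounded degree whose leading coefficients are not controlled.
\<close>

lemma poly_root_near:
  fixes p :: "complex poly"
  assumes "poly (pderiv p) z \<noteq> 0"
  shows "\<exists>x. poly p x = 0 \<and> norm (z - x) \<le> degree p * norm (poly p z) / norm (poly (pderiv p) z)"
proof (rule ccontr)
  assume "\<not> ?thesis"
  then have far: "\<And>x. poly p x = 0 \<Longrightarrow>
      degree p * norm (poly p z) / norm (poly (pderiv p) z) < norm (z - x)"
    by (meson not_le)
  have "p \<noteq> 0" "degree p \<noteq> 0" using assms by (auto simp flip: pderiv_eq_0_iff)
  define R where "R = (\<lambda>x. norm (z - x)) ` {x. poly p x = 0}"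
  have R: "finite R" "R \<noteq> {}"
    using poly_roots_finite[OF \<open>p \<noteq> 0\<close>] fundamental_theorem_of_algebra[of p]
      constant_degree[of p] \<open>degree p \<noteq> 0\<close> by (auto simp: R_def)
  from Min_in[OF R] have m: "Min R \<in> R" .
  have "Min R * norm (poly (pderiv p) z) \<le> degree p * norm (poly p z)"
  proof (rule poly_pderiv_bound)
    show "Min R \<ge> 0" using m by (auto simp: R_def)
    show "Min R \<le> norm (z - x)" if "poly p x = 0" for x
      using R(1) that by (intro Min_le) (auto simp: R_def)
  qed
  then have "Min R \<le> degree p * norm (poly p z) / norm (poly (pderiv p) z)"
    using assms by (simp add: field_simps)
  with m far show False by (force simp: R_def)
qed

lemma has_vector_derivative_iff_quotient:
  fixes f :: "real \<Rightarrow> complex"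
  shows "(f has_vector_derivative d) (at t) \<longleftrightarrow> ((\<lambda>s. (f s - f t) / of_real (s - t)) \<longlongrightarrow> d) (at t)"
proof -
  have "norm ((f s - f t) / of_real (s - t) - d) = norm (f s - f t - (s - t) *\<^sub>R d) / norm (s - t)"
    if "s \<noteq> t" for s
  proof -
    have "(f s - f t) / of_real (s - t) - d = (f s - f t - (s - t) *\<^sub>R d) / of_real (s - t)"
      using that by (simp add: diff_divide_distrib scaleR_conv_of_real)
    then show ?thesis by (simp only: norm_divide norm_of_real real_norm_def)
  qed
  then have "((\<lambda>s. norm ((f s - f t) / of_real (s - t) - d)) \<longlongrightarrow> 0) (at t) \<longleftrightarrow>
      ((\<lambda>s. norm (f s - f t - (s - t) *\<^sub>R d) / norm (s - t)) \<longlongrightarrow> 0) (at t)"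
    by (intro Lim_cong_within) auto
  then show ?thesis
    unfolding has_vector_derivative_def has_derivative_iff_norm
    by (simp add: bounded_linear_scaleR_left tendsto_norm_zero_iff flip: LIM_zero_iff[of _ d])
qed

text \<open>
  A product of a differentiable function that vanishes at the point and a factor that is merely
  continuous there: in the implicit function argument below the factor contains the root, whose
  differentiability is not yet known.
\<close>

lemma has_vector_derivative_mult_continuous:
  fixes f g :: "real \<Rightarrow> complex"
  assumes f: "(f has_vector_derivative d) (at t)" "f t = 0" and g: "isCont g t"
  shows "((\<lambda>s. f s * g s) has_vector_derivative d * g t) (at t)"
proof -
  have "((\<lambda>s. (f s - f t) / of_real (s - t) * g s) \<longlongrightarrow> d * g t) (at t)"
    using f(1) g unfolding has_vector_derivative_iff_quotient isCont_def by (intro tendsto_mult)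
  then show ?thesis unfolding has_vector_derivative_iff_quotient by (simp add: f(2))
qed

text \<open>
  An implicit function theorem for polynomials.  The divided difference \<open>Q h x y\<close>, which is
  \<open>(q\<^sub>h(x) - q\<^sub>h(y)) / (x - y)\<close> off the diagonal and \<open>q\<^sub>h'(x)\<close> on it, stays away from \<open>0\<close> near the
  simple root.  Existence of a nearby root follows from \<open>poly_root_near\<close>.  Subtracting the
  equations at two parameters expresses the increment of the root as the increment of the
  coefficients divided by \<open>Q\<close>; this yields continuity, then the derivative, and then smoothness by
  bootstrapping.
\<close>

lemma smooth_simple_root:
  fixes q :: "real \<Rightarrow> complex poly"
  assumes coeffs: "\<And>i. smooth_on U (\<lambda>h. coeff (q h) i)" and deg: "\<And>h. degree (q h) \<le> n"
    and U: "open U" "0 \<in> U"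
    and root: "poly (q 0) z0 = 0" and simple: "poly (pderiv (q 0)) z0 \<noteq> 0"
  obtains \<delta> z where "\<delta> > 0" "{-\<delta><..<\<delta>} \<subseteq> U" "smooth_on {-\<delta><..<\<delta>} z" "z 0 = z0"
    "\<And>h. \<bar>h\<bar> < \<delta> \<Longrightarrow> poly (q h) (z h) = 0"
proof -
  define c where "c i h = coeff (q h) i" for i h
  have c: "smooth_on U (c i)" for i using coeffs by (simp add: c_def[abs_def])
  have q: "poly (q h) x = (\<Sum>i\<le>n. c i h * x ^ i)" for h x
  proof -
    have "poly (q h) x = poly (\<Sum>i\<le>n. monom (coeff (q h) i) i) x"
      by (simp add: poly_as_sum_of_monoms'[OF deg])
    then show ?thesis by (simp add: poly_sum poly_monom c_def)
  qed
  define Q where "Q h x y = (\<Sum>j<n. \<Sum>k=Suc j..n. c k h * y ^ (k - Suc j) * x ^ j)" for h x y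
  have qQ: "poly (q h) x - poly (q h) y = (x - y) * Q h x y" for h x y
    unfolding q Q_def by (rule sub_polyfun)
  have Qd: "Q h x x = poly (pderiv (q h)) x" for h x
  proof (rule DERIV_unique)
    show "(poly (q h) has_field_derivative Q h x x) (at x)"
      unfolding CARAT_DERIV
    proof (intro exI[of _ "\<lambda>y. Q h y x"] conjI allI)
      show "poly (q h) y - poly (q h) x = Q h y x * (y - x)" for y by (simp add: qQ)
      show "isCont (\<lambda>y. Q h y x) x" unfolding Q_def by (intro continuous_intros)
    qed simp
  qed (rule poly_DERIV)
  define a where "a = norm (Q 0 z0 z0)"
  have a: "a > 0" using simple by (simp add: a_def Qd)
  have c0: "(c i \<longlongrightarrow> c i 0) (nhds 0)" for i
    using smooth_on_imp_isCont[OF c U(2)] by (simp add: isCont_def tendsto_at_iff_tendsto_nhds)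
  have "((\<lambda>w. norm (Q (fst w) (fst (snd w)) (snd (snd w)))) \<longlongrightarrow> a)
      (nhds 0 \<times>\<^sub>F (nhds z0 \<times>\<^sub>F nhds z0))"
    unfolding Q_def a_def
    by (intro tendsto_intros filterlim_compose[OF c0] filterlim_fst
        filterlim_compose[OF filterlim_fst filterlim_snd] filterlim_compose[OF filterlim_snd filterlim_snd])
  then have "\<forall>\<^sub>F w in nhds 0 \<times>\<^sub>F (nhds z0 \<times>\<^sub>F nhds z0).
      a / 2 < norm (Q (fst w) (fst (snd w)) (snd (snd w)))"
    by (rule order_tendstoD) (use a in simp)
  then obtain P1 P2 P3 where P: "eventually P1 (nhds 0)" "eventually P2 (nhds z0)" "eventually P3 (nhds z0)"
    "\<And>h x y. P1 h \<Longrightarrow> P2 x \<Longrightarrow> P3 y \<Longrightarrow> a / 2 < norm (Q h x y)"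
    unfolding eventually_prod_filter by fastforce
  have "\<forall>\<^sub>F x in nhds z0. P2 x \<and> P3 x" using P(2,3) by (rule eventually_conj)
  then obtain r where r: "r > 0" "\<And>x. norm (z0 - x) < r \<Longrightarrow> P2 x \<and> P3 x"
    unfolding eventually_nhds_metric by (metis dist_commute dist_norm)
  have Qbig: "a / 2 < norm (Q h x y)" if "P1 h" "norm (z0 - x) < r" "norm (z0 - y) < r" for h x y
    using P(4) r(2) that by blast
  have "((\<lambda>h. norm (poly (q h) z0)) \<longlongrightarrow> norm (poly (q 0) z0)) (nhds 0)"
    unfolding q by (intro tendsto_intros c0)
  then have "\<forall>\<^sub>F h in nhds 0. norm (poly (q h) z0) < r * (a / 2) / (n + 1)"
    by (rule order_tendstoD) (use root r(1) a in simp)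
  moreover have "\<forall>\<^sub>F h in nhds 0. h \<in> U" using U by (simp add: eventually_nhds_in_open)
  ultimately have "\<forall>\<^sub>F h in nhds 0. norm (poly (q h) z0) < r * (a / 2) / (n + 1) \<and> P1 h \<and> h \<in> U"
    using P(1) by (simp add: eventually_conj)
  then obtain \<delta> where \<delta>: "\<delta> > 0"
    "\<And>h. \<bar>h\<bar> < \<delta> \<Longrightarrow> norm (poly (q h) z0) < r * (a / 2) / (n + 1) \<and> P1 h \<and> h \<in> U"
    unfolding eventually_nhds_metric by auto
  have "\<exists>x. poly (q h) x = 0 \<and> norm (z0 - x) < r" if h: "\<bar>h\<bar> < \<delta>" for h
  proof -
    have big: "a / 2 < norm (poly (pderiv (q h)) z0)"
      using Qbig[of h z0 z0] \<delta>(2)[OF h] r(1) by (simp add: Qd)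
    then have "poly (pderiv (q h)) z0 \<noteq> 0" using a by auto
    from poly_root_near[OF this] obtain x where x: "poly (q h) x = 0"
      "norm (z0 - x) \<le> degree (q h) * norm (poly (q h) z0) / norm (poly (pderiv (q h)) z0)" by blast
    note x(2)
    also have "\<dots> \<le> n * norm (poly (q h) z0) / (a / 2)"
      using deg[of h] big a by (intro frac_le mult_right_mono mult_nonneg_nonneg) auto
    also have "\<dots> \<le> (n + 1) * norm (poly (q h) z0) / (a / 2)"
      using a by (intro divide_right_mono mult_right_mono) auto
    also have "\<dots> < r"
      using \<delta>(2)[OF h] a by (simp add: field_simps)
    finally show ?thesis using x(1) by blast
  qed
  then obtain z where z: "\<And>h. \<bar>h\<bar> < \<delta> \<Longrightarrow> poly (q h) (z h) = 0 \<and> norm (z0 - z h) < r" by metis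
  have Qz: "a / 2 < norm (Q s (z s) (z t))" if "\<bar>s\<bar> < \<delta>" "\<bar>t\<bar> < \<delta>" for s t
    using Qbig \<delta>(2) z that by blast
  have z0: "z 0 = z0"
  proof -
    have "(z 0 - z0) * Q 0 (z 0) z0 = 0" using qQ[of 0 "z 0" z0] z[of 0] \<delta>(1) root by simp
    moreover have "a / 2 < norm (Q 0 (z 0) z0)"
      using Qbig[of 0 "z 0" z0] z[of 0] \<delta> r(1) by auto
    ultimately show ?thesis using a by auto
  qed
  \<comment> \<open>The increment of the polynomial in the parameter, evaluated at the fixed root \<open>z t\<close>.\<close>
  define N where "N t s = (\<Sum>i\<le>n. (c i s - c i t) * z t ^ i)" for s t
  have diff: "(z s - z t) * Q s (z s) (z t) = - N t s" if "\<bar>s\<bar> < \<delta>" "\<bar>t\<bar> < \<delta>" for s t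
  proof -
    have "(z s - z t) * Q s (z s) (z t) = poly (q t) (z t) - poly (q s) (z t)"
      using z that qQ[of s "z s" "z t"] by simp
    then show ?thesis by (simp add: q N_def left_diff_distrib sum_subtractf)
  qed
  let ?I = "{-\<delta><..<\<delta>}"
  have IU: "?I \<subseteq> U" using \<delta>(2) by auto
  have near: "\<forall>\<^sub>F s in nhds t. \<bar>s\<bar> < \<delta>" if "t \<in> ?I" for t
    using eventually_nhds_in_open[of ?I t] that by (auto elim: eventually_mono)
  have cont: "isCont z t" if t: "t \<in> ?I" for t
  proof -
    have "isCont (c i) t" for i using smooth_on_imp_isCont[OF c] t IU by blast
    then have "isCont (N t) t" unfolding N_def[abs_def] by (intro continuous_intros)
    then have "((\<lambda>s. norm (N t s) / (a / 2)) \<longlongrightarrow> norm (N t t) / (a / 2)) (at t)"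
      unfolding isCont_def using a by (intro tendsto_intros) auto
    then have "((\<lambda>s. norm (N t s) / (a / 2)) \<longlongrightarrow> 0) (at t)" by (simp add: N_def)
    moreover have "\<forall>\<^sub>F s in at t. norm (z s - z t) \<le> norm (N t s) / (a / 2)"
    proof (rule eventually_mono[OF eventually_at_filter[THEN iffD2, OF eventually_mono[OF near[OF t]]]])
      fix s assume s: "\<bar>s\<bar> < \<delta>"
      have at: "\<bar>t\<bar> < \<delta>" using t by auto
      have "norm (z s - z t) * (a / 2) \<le> norm (z s - z t) * norm (Q s (z s) (z t))"
        using Qz[OF s at] by (intro mult_left_mono) auto
      also have "\<dots> = norm (N t s)" using diff[OF s at] by (simp flip: norm_mult)
      finally show "norm (z s - z t) \<le> norm (N t s) / (a / 2)" using a by (simp add: field_simps)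
    qed auto
    ultimately have "((\<lambda>s. z s - z t) \<longlongrightarrow> 0) (at t)"
      by (rule Lim_null_comparison[rotated])
    then show ?thesis by (simp add: isCont_def LIM_zero_iff)
  qed
  have "\<forall>i. \<exists>f'. (\<forall>t\<in>U. (c i has_vector_derivative f' t) (at t)) \<and> smooth_on U f'"
  proof
    fix i
    obtain f' where "\<And>t. t \<in> U \<Longrightarrow> (c i has_vector_derivative f' t) (at t)" "smooth_on U f'"
      using smooth_onE[OF c[of i] U(1)] by blast
    then show "\<exists>f'. (\<forall>t\<in>U. (c i has_vector_derivative f' t) (at t)) \<and> smooth_on U f'" by blast
  qed
  from choice[OF this] obtain c' where
    c': "\<And>i t. t \<in> U \<Longrightarrow> (c i has_vector_derivative c' i t) (at t)" "\<And>i. smooth_on U (c' i)"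
    by blast
  define G where "G t = inverse (Q t (z t) (z t))" for t
  have Qk: "kdiff k ?I (\<lambda>t. Q t (z t) (z t))" if "kdiff k ?I z" for k
    unfolding Q_def
    by (intro kdiff_sum kdiff_mult kdiff_power that kdiff_mono_set[OF smooth_on_kdiff[OF c] IU])
  have Q0: "Q s (z s) (z t) \<noteq> 0" if "s \<in> ?I" "t \<in> ?I" for s t
    using Qz[of s t] that a by (auto simp: abs_less_iff)
  have "smooth_on ?I z"
  proof (rule smooth_on_bootstrap)
    fix t assume t: "t \<in> ?I"
    have "(N t has_vector_derivative (\<Sum>i\<le>n. c' i t * z t ^ i)) (at t)"
      unfolding N_def[abs_def] using c'(1) t IU
      by (auto intro!: derivative_eq_intros has_vector_derivative_sum)
    moreover have "isCont (\<lambda>s. - inverse (Q s (z s) (z t))) t"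
    proof -
      have "isCont (c i) t" for i using smooth_on_imp_isCont[OF c] t IU by blast
      then show ?thesis
        using Q0[OF t t] cont[OF t] unfolding Q_def by (intro continuous_intros) auto
    qed
    ultimately have "((\<lambda>s. N t s * - inverse (Q s (z s) (z t))) has_vector_derivative
        (\<Sum>i\<le>n. c' i t * z t ^ i) * - inverse (Q t (z t) (z t))) (at t)"
      by (intro has_vector_derivative_mult_continuous) (simp_all add: N_def[of t t])
    then have "((\<lambda>s. z s - z t) has_vector_derivative
        (\<Sum>i\<le>n. c' i t * z t ^ i) * - inverse (Q t (z t) (z t))) (at t)"
    proof (rule has_vector_derivative_transform_within_open[of _ _ _ ?I])
      fix s assume s: "s \<in> ?I"
      have "\<bar>s\<bar> < \<delta>" "\<bar>t\<bar> < \<delta>" using s t by (auto simp: abs_less_iff)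
      from diff[OF this] show "N t s * - inverse (Q s (z s) (z t)) = z s - z t"
        using Q0[OF s t] by (simp add: field_simps)
    qed (use t in auto)
    from has_vector_derivative_add[OF this has_vector_derivative_const[of "z t"]]
    show "(z has_vector_derivative (\<Sum>i\<le>n. c' i t * z t ^ i) * - G t) (at t)"
      by (simp add: G_def)
  next
    fix k assume k: "kdiff k ?I z"
    have "kdiff k ?I G"
      unfolding G_def by (rule kdiff_inverse[OF Qk[OF k]]) (rule Q0)
    then show "kdiff k ?I (\<lambda>t. (\<Sum>i\<le>n. c' i t * z t ^ i) * - G t)"
      by (intro kdiff_sum kdiff_mult kdiff_uminus kdiff_power k
          kdiff_mono_set[OF smooth_on_kdiff[OF c'(2)] IU])
  qed
  with \<delta>(1) IU z0 z show ?thesis by (intro that[of \<delta> z]) auto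
qed

section \<open>Diagonal matrices and diagonalisation\<close>

definition diag_mat :: "('m \<Rightarrow> 'a::zero) \<Rightarrow> 'a ^ 'm::finite ^ 'm" where
  "diag_mat d = (\<chi> i j. if i = j then d i else 0)"

lemma mult_diag_mat: "(A ** diag_mat d) $ i $ j = A $ i $ j * d j"
  for A :: "'a::semiring_1 ^ 'm::finite ^ 'l::finite"
  by (simp add: matrix_matrix_mult_def diag_mat_def if_distrib cong: if_cong)

lemma diag_mat_mult_vec: "(diag_mat d *v u) $ i = d i * u $ i"
  for d :: "'m::finite \<Rightarrow> 'a::semiring_1"
proof -
  have "(diag_mat d *v u) $ i = (\<Sum>j\<in>UNIV. if j = i then d i * u $ j else 0)"
    by (simp only: matrix_vector_mult_def vec_lambda_beta, intro sum.cong) (auto simp: diag_mat_def)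
  then show ?thesis by simp
qed

lemma matrix_mult_nth_column: "(A ** B) $ i $ j = (A *v column j B) $ i"
  by (simp add: matrix_matrix_mult_def matrix_vector_mult_def column_def)

lemma column_eigen_imp_mult_diag:
  fixes A M :: "'a::comm_semiring_1 ^ 'm::finite ^ 'm"
  assumes "\<And>j. A *v column j M = d j *s column j M"
  shows "A ** M = M ** diag_mat d"
proof -
  have "(A ** M) $ i $ j = (M ** diag_mat d) $ i $ j" for i j
    unfolding matrix_mult_nth_column[of A] assms mult_diag_mat by (simp add: column_def mult.commute)
  then show ?thesis by (simp add: vec_eq_iff)
qed

text \<open>
  In the basis formed by the columns of \<open>M\<close> an eigenvector of \<open>A\<close> is one of a diagonal matrix,
  and a nonzero coordinate identifies the eigenvalue.
\<close>

lemma spectrum_diagonalised: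
  fixes A M :: "'a::field ^ 'm::finite ^ 'm"
  assumes AM: "A ** M = M ** diag_mat d" and M: "N ** M = mat 1"
  shows "spectrum A = range d"
proof (intro set_eqI iffI)
  have MN: "M ** N = mat 1" using M matrix_left_right_inverse by blast
  fix z
  {
    assume "z \<in> spectrum A"
    then obtain u where u: "u \<noteq> 0" "A *v u = z *s u" by (auto simp: spectrum_def)
    define c where "c = N *v u"
    have uc: "u = M *v c" by (simp add: c_def matrix_vector_mul_assoc MN)
    then have "c \<noteq> 0" using u(1) by auto
    then obtain j where j: "c $ j \<noteq> 0" by (auto simp: vec_eq_iff)
    have "M *v (diag_mat d *v c) = M *v (z *s c)"
      using u(2) by (simp add: uc matrix_vector_mul_assoc AM vector_scalar_commute)
    then have "N *v (M *v (diag_mat d *v c)) = N *v (M *v (z *s c))" by simp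
    then have "diag_mat d *v c = z *s c" by (simp add: matrix_vector_mul_assoc M matrix_mul_assoc)
    then have "d j * c $ j = z * c $ j" by (metis diag_mat_mult_vec vector_smult_component)
    with j show "z \<in> range d" by auto
  next
    assume "z \<in> range d"
    then obtain j where z: "z = d j" by auto
    have "(A *v column j M) $ i = (d j *s column j M) $ i" for i
      unfolding matrix_mult_nth_column[symmetric] AM mult_diag_mat
      by (simp add: column_def mult.commute)
    then have "A *v column j M = d j *s column j M" by (simp add: vec_eq_iff)
    moreover have "column j M \<noteq> 0"
    proof
      assume "column j M = 0"
      then have "(N ** M) $ j $ j = 0" by (simp add: matrix_mult_nth_column)
      with M show False by (simp add: mat_def)
    qed
    ultimately show "z \<in> spectrum A" by (auto simp: spectrum_def z)
  }
qed

lemma matrix_cancel_right: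
  fixes X Y :: "'a::semiring_1 ^ 'm::finite ^ 'm"
  shows "X ** Y = mat 1 \<Longrightarrow> A ** X ** Y = A"
  by (simp add: matrix_mul_assoc[symmetric])

lemma spectrum_similar_subset:
  fixes A X Y :: "'a::field ^ 'm::finite ^ 'm"
  assumes "X ** Y = mat 1" "Y ** X = mat 1"
  shows "spectrum A \<subseteq> spectrum (X ** A ** Y)"
proof
  fix z assume "z \<in> spectrum A"
  then obtain v where v: "v \<noteq> 0" "A *v v = z *s v" by (auto simp: spectrum_def)
  have "Y *v (X *v v) = v" by (simp add: matrix_vector_mul_assoc assms)
  then have "X *v v \<noteq> 0" using v(1) by auto
  moreover have "(X ** A ** Y) *v (X *v v) = X *v (A *v v)"
    by (simp add: matrix_vector_mul_assoc matrix_cancel_right[OF assms(2)])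
  ultimately show "z \<in> spectrum (X ** A ** Y)"
    using v(2) by (auto simp: spectrum_def vector_scalar_commute)
qed

lemma spectrum_similar:
  fixes A X Y :: "'a::field ^ 'm::finite ^ 'm"
  assumes "X ** Y = mat 1" "Y ** X = mat 1"
  shows "spectrum (X ** A ** Y) = spectrum A"
proof
  have "Y ** (X ** A ** Y) ** X = A"
    by (simp add: matrix_mul_assoc assms matrix_cancel_right)
  then show "spectrum (X ** A ** Y) \<subseteq> spectrum A"
    using spectrum_similar_subset[OF assms(2,1), of "X ** A ** Y"] by simp
qed (rule spectrum_similar_subset[OF assms])

lemma matrix_diff_conj: "A ** (X - Y) ** B = A ** X ** B - A ** Y ** B"
  for A B X Y :: "'a::ring_1 ^ 'm::finite ^ 'm"
  by (simp add: matrix_matrix_mult_def vec_eq_iff sum_subtractf left_diff_distrib right_diff_distrib)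

section \<open>Simple eigenvalues of a smooth family of matrices\<close>

text \<open>
  The determinant is taken over the polynomial ring, with the sign convention \<open>det (A - z)\<close>, so
  that the coefficients are visibly polynomial in the entries.
\<close>

definition charpoly :: "'a::comm_ring_1 ^ 'm::finite ^ 'm \<Rightarrow> 'a poly" where
  "charpoly A = det (\<chi> i j. [:A $ i $ j, if i = j then - 1 else 0:])"

lemma poly_charpoly: "poly (charpoly A) z = det (A - mat z)"
  by (simp add: charpoly_def det_def poly_sum poly_prod mat_def)
     (intro sum.cong prod.cong refl arg_cong2[where f="(*)"], auto)

lemma degree_charpoly_le:
  fixes A :: "'a::comm_ring_1 ^ 'm::finite ^ 'm"
  shows "degree (charpoly A) \<le> CARD('m)"
  unfolding charpoly_def det_def
proof (intro degree_sum_le finite_permutations finite)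
  fix \<pi> :: "'m \<Rightarrow> 'm"
  let ?f = "\<lambda>i. (\<chi> i j. [:A $ i $ j, if i = j then - 1 else 0:]) $ i $ \<pi> i"
  have "degree (of_int (sign \<pi>) * prod ?f UNIV) \<le> degree (of_int (sign \<pi>) :: 'a poly) + degree (prod ?f UNIV)"
    by (rule degree_mult_le)
  also have "\<dots> \<le> 0 + sum (degree \<circ> ?f) UNIV"
    by (intro add_mono degree_prod_sum_le finite) simp
  also have "\<dots> \<le> 0 + (\<Sum>i\<in>(UNIV::'m set). 1)"
    by (intro add_mono sum_mono order_refl) simp
  finally show "degree (of_int (sign \<pi>) * prod ?f UNIV) \<le> CARD('m)" by simp
qed

lemma smooth_on_coeff_prod:
  fixes F :: "'i \<Rightarrow> real \<Rightarrow> 'a::real_normed_field poly"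
  assumes "\<And>i n. i \<in> I \<Longrightarrow> smooth_on U (\<lambda>h. coeff (F i h) n)"
  shows "smooth_on U (\<lambda>h. coeff (\<Prod>i\<in>I. F i h) n)"
  using assms
proof (induction I arbitrary: n rule: infinite_finite_induct)
  case (insert x I)
  then show ?case
    by (simp add: coeff_mult) (intro smooth_intros; simp)
qed (simp_all add: smooth_on_const)

lemma smooth_on_coeff_charpoly:
  fixes A :: "real \<Rightarrow> 'a::real_normed_field ^ 'm::finite ^ 'm"
  assumes A: "\<And>i j. smooth_on U (\<lambda>h. A h $ i $ j)"
  shows "smooth_on U (\<lambda>h. coeff (charpoly (A h)) n)"
proof -
  have e: "smooth_on U (\<lambda>h. coeff [:A h $ i $ j, b:] n)" for i j b n
    by (cases n) (auto intro: A smooth_on_const simp: coeff_pCons split: nat.split)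
  have "smooth_on U (\<lambda>h. coeff (of_int c * (\<Prod>i\<in>(UNIV::'m set). [:A h $ i $ \<pi> i, if i = \<pi> i then - 1 else 0:])) n)"
    for c :: int and \<pi>
    unfolding coeff_mult by (intro smooth_intros smooth_on_coeff_prod e)
  then show ?thesis
    unfolding charpoly_def det_def coeff_sum by (intro smooth_on_sum) simp
qed

lemma det_eq_0_iff_kernel:
  fixes A :: "'a::field ^ 'm::finite ^ 'm"
  shows "det A = 0 \<longleftrightarrow> (\<exists>v. v \<noteq> 0 \<and> A *v v = 0)"
proof -
  have "det A \<noteq> 0 \<longleftrightarrow> (\<exists>B. B ** A = mat 1)"
    by (metis invertible_det_nz invertible_left_inverse)
  then show ?thesis by (auto simp: matrix_left_invertible_ker)
qed

lemma poly_charpoly_eq_0_iff: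
  fixes A :: "'a::field ^ 'm::finite ^ 'm"
  shows "poly (charpoly A) z = 0 \<longleftrightarrow> z \<in> spectrum A"
proof -
  have "mat z *v v = z *s v" for v :: "'a ^ 'm"
    by (simp add: vec_eq_iff matrix_vector_mult_def mat_def if_distrib if_distribR cong: if_cong)
  then show ?thesis
    by (simp add: spectrum_def poly_charpoly det_eq_0_iff_kernel matrix_vector_mult_diff_rdistrib)
qed

lemma charpoly_diag_mat: "charpoly (diag_mat d) = (\<Prod>i\<in>UNIV. [:d i, - 1:])"
  unfolding charpoly_def by (subst det_diagonal) (auto simp: diag_mat_def)

text \<open>
  The eigenvalue is a simple root of the characteristic polynomial.  The eigenvector normalised
  by \<open>v\<^sub>k = 1\<close> solves the linear system obtained from \<open>(B - \<mu>) v = 0\<close> by replacing the equation of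
  row \<open>k\<close> with that normalisation.  At \<open>h = 0\<close> the new matrix is diagonal and invertible, so Cramer's
  rule gives a smooth solution.  Row \<open>k\<close> of the eigenvector equation, which was discarded, is
  recovered from the singularity of \<open>B - \<mu>\<close>: any kernel vector solves the modified system up to a
  scalar, and so is proportional to \<open>v\<close>.
\<close>

lemma smooth_eigenpair:
  fixes B :: "real \<Rightarrow> complex ^ 'm::finite ^ 'm" and d :: "'m \<Rightarrow> complex"
  assumes B: "\<And>i j. smooth_on U (\<lambda>h. B h $ i $ j)" and U: "open U" "0 \<in> U"
    and B0: "B 0 = diag_mat d" and d: "inj d"
  obtains \<delta> \<mu> v where "\<delta> > 0" "{-\<delta><..<\<delta>} \<subseteq> U" "smooth_on {-\<delta><..<\<delta>} \<mu>"
    "\<And>i. smooth_on {-\<delta><..<\<delta>} (\<lambda>h. v h $ i)" "\<mu> 0 = d k"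
    "\<And>h. \<bar>h\<bar> < \<delta> \<Longrightarrow> B h *v v h = \<mu> h *s v h" "\<And>h. \<bar>h\<bar> < \<delta> \<Longrightarrow> v h $ k = 1"
proof -
  define R where "R = (\<Prod>i\<in>UNIV - {k}. [:d i, - 1:])"
  have fact: "charpoly (B 0) = [:d k, - 1:] * R"
    unfolding B0 charpoly_diag_mat R_def by (subst prod.remove[of _ k]) auto
  have root: "poly (charpoly (B 0)) (d k) = 0" unfolding fact by simp
  have "poly R (d k) \<noteq> 0" unfolding R_def poly_prod using d by (auto simp: inj_eq)
  then have simple: "poly (pderiv (charpoly (B 0))) (d k) \<noteq> 0"
    unfolding fact pderiv_mult by (simp add: pderiv_pCons)
  obtain \<delta>1 \<mu> where \<delta>1: "\<delta>1 > 0" "{-\<delta>1<..<\<delta>1} \<subseteq> U" and \<mu>: "smooth_on {-\<delta>1<..<\<delta>1} \<mu>" "\<mu> 0 = d k"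
    "\<And>h. \<bar>h\<bar> < \<delta>1 \<Longrightarrow> poly (charpoly (B h)) (\<mu> h) = 0"
    using smooth_simple_root[of U "\<lambda>h. charpoly (B h)", OF smooth_on_coeff_charpoly[OF B]
        degree_charpoly_le U root simple] by blast
  define C where "C h = (\<chi> i j. if i = k then if j = k then 1 else 0
      else B h $ i $ j - (if i = j then \<mu> h else 0))" for h
  have C: "smooth_on {-\<delta>1<..<\<delta>1} (\<lambda>h. C h $ i $ j)" for i j
    unfolding C_def
    by (cases "i = k"; cases "i = j")
       (auto intro!: smooth_intros \<mu>(1) smooth_on_subset[OF B \<delta>1(2)])
  have "C 0 = diag_mat (\<lambda>i. if i = k then 1 else d i - d k)"
    by (auto simp: C_def diag_mat_def vec_eq_iff \<mu>(2) B0)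
  then have "det (C 0) = (\<Prod>i\<in>UNIV. if i = k then 1 else d i - d k)"
    by (subst det_diagonal) (auto simp: diag_mat_def)
  then have C0: "det (C 0) \<noteq> 0" using d by (auto simp: inj_eq)
  have "isCont (\<lambda>h. det (C h)) 0"
    by (rule smooth_on_imp_isCont[OF smooth_on_det[OF C]]) (use \<delta>1(1) in simp)
  from continuous_at_avoid[OF this C0] obtain \<epsilon> where \<epsilon>: "\<epsilon> > 0"
    "\<And>h. dist 0 h < \<epsilon> \<Longrightarrow> det (C h) \<noteq> 0" by blast
  define \<delta> where "\<delta> = min \<delta>1 \<epsilon>"
  have \<delta>: "\<delta> > 0" "\<delta> \<le> \<delta>1" using \<delta>1(1) \<epsilon>(1) by (auto simp: \<delta>_def)
  have det: "det (C h) \<noteq> 0" if "\<bar>h\<bar> < \<delta>" for h using \<epsilon>(2)[of h] that by (simp add: \<delta>_def)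
  have sub: "{-\<delta><..<\<delta>} \<subseteq> {-\<delta>1<..<\<delta>1}" using \<delta>(2) by auto
  define v where "v h = (\<chi> l. det (\<chi> i j. if j = l then axis k 1 $ i else C h $ i $ j) / det (C h))" for h
  have Cv: "C h *v x = axis k 1 \<longleftrightarrow> x = v h" if "\<bar>h\<bar> < \<delta>" for h x
    unfolding v_def by (rule cramer[OF det[OF that]])
  have rowk: "(C h *v x) $ k = x $ k" for h x
  proof -
    have "(C h *v x) $ k = (\<Sum>j\<in>UNIV. if j = k then x $ j else 0)"
      by (simp only: matrix_vector_mult_def vec_lambda_beta, intro sum.cong) (auto simp: C_def)
    then show ?thesis by simp
  qed
  have rowi: "(C h *v x) $ i = (B h *v x) $ i - \<mu> h * x $ i" if "i \<noteq> k" for h x i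
  proof -
    have "(C h *v x) $ i = (\<Sum>j\<in>UNIV. B h $ i $ j * x $ j - (if i = j then \<mu> h * x $ j else 0))"
      by (simp only: matrix_vector_mult_def vec_lambda_beta, intro sum.cong) (auto simp: C_def that left_diff_distrib)
    then show ?thesis by (simp add: sum_subtractf matrix_vector_mult_def)
  qed
  have vk: "v h $ k = 1" if "\<bar>h\<bar> < \<delta>" for h
    using Cv[OF that, of "v h"] rowk[of h "v h"] by simp
  have eig: "B h *v v h = \<mu> h *s v h" if h: "\<bar>h\<bar> < \<delta>" for h
  proof -
    have "poly (charpoly (B h)) (\<mu> h) = 0" using \<mu>(3) h \<delta>(2) by simp
    then obtain u where u: "u \<noteq> 0" "B h *v u = \<mu> h *s u"
      unfolding poly_charpoly_eq_0_iff spectrum_def by blast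
    have "(C h *v u) $ i = (u $ k *s axis k 1) $ i" for i
    proof (cases "i = k")
      case False
      with u(2) show ?thesis by (simp add: rowi axis_def)
    qed (use rowk in \<open>simp add: axis_def\<close>)
    then have Cu: "C h *v u = u $ k *s axis k 1" by (simp add: vec_eq_iff)
    \<comment> \<open>Otherwise \<open>u\<close> would be a kernel vector of the invertible matrix \<open>C h\<close>.\<close>
    have "u $ k \<noteq> 0"
    proof
      assume "u $ k = 0"
      with Cu have "C h *v u = 0" by simp
      with det[OF h] u(1) show False using det_eq_0_iff_kernel by blast
    qed
    with Cu have "C h *v (inverse (u $ k) *s u) = axis k 1"
      by (simp add: matrix_vector_mult_scaleR vector_scalar_commute vector_smult_assoc)
    then have "v h = inverse (u $ k) *s u" using Cv[OF h] by simp
    with u(2) show ?thesis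
      by (simp add: vector_scalar_commute vector_smult_assoc mult.commute)
  qed
  have "smooth_on {-\<delta><..<\<delta>} (\<lambda>h. v h $ l)" for l
  proof -
    have "smooth_on {-\<delta><..<\<delta>} (\<lambda>h. (\<chi> i j. if j = l then axis k 1 $ i else C h $ i $ j) $ i $ j)" for i j
      by (cases "j = l") (auto intro!: smooth_intros smooth_on_subset[OF C sub])
    then show ?thesis
      unfolding v_def using det
      by (auto intro!: smooth_intros smooth_on_subset[OF C sub] simp: abs_less_iff)
  qed
  with \<delta>(1) sub \<delta>1(2) \<mu>(2) eig vk smooth_on_subset[OF \<mu>(1) sub] show ?thesis
    by (intro that[of \<delta> \<mu> v]) auto
qed

text \<open>
  The normalisation \<open>v\<^sub>k = 1\<close> determines the basis completely at \<open>h = 0\<close>, where it is the standard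
  one.
\<close>

lemma smooth_eigenbasis:
  fixes B :: "real \<Rightarrow> complex ^ 'm::finite ^ 'm" and d :: "'m \<Rightarrow> complex"
  assumes B: "\<And>i j. smooth_on U (\<lambda>h. B h $ i $ j)" and U: "open U" "0 \<in> U"
    and B0: "B 0 = diag_mat d" and d: "inj d"
  obtains \<delta> \<mu> V where "\<delta> > 0" "\<And>k. smooth_on {-\<delta><..<\<delta>} (\<mu> k)"
    "\<And>i j. smooth_on {-\<delta><..<\<delta>} (\<lambda>h. V h $ i $ j)" "\<And>k. \<mu> k 0 = d k" "V 0 = mat 1"
    "\<And>h k. \<bar>h\<bar> < \<delta> \<Longrightarrow> B h *v column k (V h) = \<mu> k h *s column k (V h)"
    "\<And>h k. \<bar>h\<bar> < \<delta> \<Longrightarrow> V h $ k $ k = 1"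
proof -
  \<comment> \<open>Only finitely many eigenpairs are chosen, so their intervals have a common subinterval.\<close>
  define Q where "Q k \<delta> \<mu> v \<longleftrightarrow> \<delta> > 0 \<and> smooth_on {-\<delta><..<\<delta>} \<mu> \<and>
    (\<forall>i. smooth_on {-\<delta><..<\<delta>} (\<lambda>h. v h $ i)) \<and> \<mu> 0 = d k \<and>
    (\<forall>h. \<bar>h\<bar> < \<delta> \<longrightarrow> B h *v v h = \<mu> h *s v h \<and> v h $ k = 1)"
    for k and \<delta> :: real and \<mu> and v :: "real \<Rightarrow> complex ^ 'm"
  have "\<exists>\<delta> \<mu> v. Q k \<delta> \<mu> v" for k
  proof (rule smooth_eigenpair[OF B U B0 d, of k])
    fix \<delta> \<mu> v
    assume "\<delta> > 0" "smooth_on {-\<delta><..<\<delta>} \<mu>" "\<And>i. smooth_on {-\<delta><..<\<delta>} (\<lambda>h. v h $ i)" "\<mu> 0 = d k"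
      "\<And>h. \<bar>h\<bar> < \<delta> \<Longrightarrow> B h *v v h = \<mu> h *s v h" "\<And>h. \<bar>h\<bar> < \<delta> \<Longrightarrow> v h $ k = 1"
    then have "Q k \<delta> \<mu> v" by (simp add: Q_def)
    then show ?thesis by blast
  qed
  then obtain \<delta>' \<mu> v where Q: "\<And>k. Q k (\<delta>' k) (\<mu> k) (v k)" by metis
  define \<delta> where "\<delta> = Min (range \<delta>')"
  have \<delta>: "\<delta> > 0" "\<And>k. \<delta> \<le> \<delta>' k" using Q by (auto simp: \<delta>_def Q_def)
  have sub: "{-\<delta><..<\<delta>} \<subseteq> {-\<delta>' k<..<\<delta>' k}" for k using \<delta>(2)[of k] by auto
  define V where "V h = (\<chi> i j. v j h $ i)" for h
  have col: "column k (V h) = v k h" for h k by (simp add: V_def column_def)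
  have lt: "\<bar>h\<bar> < \<delta>' k" if "\<bar>h\<bar> < \<delta>" for h k using that \<delta>(2)[of k] by linarith
  have Q': "B h *v v k h = \<mu> k h *s v k h" "v k h $ k = 1" if "\<bar>h\<bar> < \<delta>" for h k
    using Q[of k] lt[OF that, of k] by (auto simp: Q_def)
  have \<mu>0: "\<mu> k 0 = d k" for k using Q[of k] by (simp add: Q_def)
  have "v k 0 $ i = (if i = k then 1 else 0)" for i k
  proof (cases "i = k")
    case False
    have "(B 0 *v v k 0) $ i = d i * v k 0 $ i"
      by (simp add: B0 diag_mat_def matrix_vector_mult_def if_distrib if_distribR cong: if_cong)
    moreover have "(B 0 *v v k 0) $ i = d k * v k 0 $ i"
      using Q'(1)[of 0 k] \<delta>(1) by (simp add: \<mu>0)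
    ultimately show ?thesis using False d by (auto simp: inj_eq)
  qed (use Q'(2)[of 0 k] \<delta>(1) in simp)
  then have "V 0 = mat 1" by (simp add: V_def mat_def vec_eq_iff)
  moreover have "smooth_on {-\<delta><..<\<delta>} (\<lambda>h. V h $ i $ j)" for i j
    using Q[of j] by (auto simp: V_def Q_def intro: smooth_on_subset[OF _ sub])
  moreover have "smooth_on {-\<delta><..<\<delta>} (\<mu> k)" for k
    using Q[of k] by (auto simp: Q_def intro: smooth_on_subset[OF _ sub])
  moreover have "V h $ k $ k = 1" if "\<bar>h\<bar> < \<delta>" for h k
    using Q'(2)[OF that] by (simp add: V_def)
  ultimately show ?thesis
    using \<delta>(1) Q'(1) \<mu>0 by (intro that[of \<delta> \<mu> V]) (auto simp: col)
qed

section \<open>Order of vanishing at zero\<close>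

text \<open>
  The relation \<open>f = O(h\<^sup>p)\<close> for \<open>h \<rightarrow> 0\<close> and functions with values in an arbitrary normed space,
  for instance vectors and matrices.
\<close>

definition vanishes :: "nat \<Rightarrow> (real \<Rightarrow> 'a::real_normed_vector) \<Rightarrow> bool" where
  "vanishes p f \<longleftrightarrow> (\<exists>C. \<forall>\<^sub>F h in at 0. norm (f h) \<le> C * \<bar>h\<bar> ^ p)"

lemma vanishes_iff_bigo: "vanishes p f \<longleftrightarrow> (\<lambda>h. norm (f h)) \<in> O[at 0](\<lambda>h. h ^ p)"
proof
  assume "vanishes p f"
  then show "(\<lambda>h. norm (f h)) \<in> O[at 0](\<lambda>h. h ^ p)"
    by (auto simp: vanishes_def power_abs intro: bigoI)
next
  assume "(\<lambda>h. norm (f h)) \<in> O[at 0](\<lambda>h. h ^ p)"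
  then show "vanishes p f"
    by (auto simp: vanishes_def power_abs elim!: landau_o.bigE)
qed

lemma vanishes_cong:
  assumes "\<forall>\<^sub>F h in at 0. norm (f h) = norm (g h)"
  shows "vanishes p f \<longleftrightarrow> vanishes p g"
proof -
  have "(\<forall>\<^sub>F h in at 0. norm (f h) \<le> C * \<bar>h\<bar> ^ p) \<longleftrightarrow> (\<forall>\<^sub>F h in at 0. norm (g h) \<le> C * \<bar>h\<bar> ^ p)" for C
    by (rule eventually_cong[OF assms]) simp
  then show ?thesis by (simp add: vanishes_def)
qed

lemma vanishes_le:
  assumes "vanishes p f" "\<forall>\<^sub>F h in at 0. norm (g h) \<le> norm (f h)"
  shows "vanishes p g"
proof -
  obtain C where "\<forall>\<^sub>F h in at 0. norm (f h) \<le> C * \<bar>h\<bar> ^ p" using assms(1) by (auto simp: vanishes_def)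
  with assms(2) have "\<forall>\<^sub>F h in at 0. norm (g h) \<le> C * \<bar>h\<bar> ^ p"
    by eventually_elim linarith
  then show ?thesis by (auto simp: vanishes_def)
qed

lemma vanishes_zero: "vanishes p (\<lambda>h. 0)"
  by (auto simp: vanishes_def intro!: exI[of _ 0])

lemma vanishes_add:
  assumes "vanishes p f" "vanishes p g"
  shows "vanishes p (\<lambda>h. f h + g h)"
proof -
  obtain C D where "\<forall>\<^sub>F h in at 0. norm (f h) \<le> C * \<bar>h\<bar> ^ p"
    "\<forall>\<^sub>F h in at 0. norm (g h) \<le> D * \<bar>h\<bar> ^ p" using assms by (auto simp: vanishes_def)
  then have "\<forall>\<^sub>F h in at 0. norm (f h + g h) \<le> (C + D) * \<bar>h\<bar> ^ p"
  proof eventually_elim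
    case (elim h)
    with norm_triangle_ineq[of "f h" "g h"] show ?case by (simp add: distrib_right)
  qed
  then show ?thesis by (auto simp: vanishes_def)
qed

lemma vanishes_sum: "(\<And>i. i \<in> I \<Longrightarrow> vanishes p (f i)) \<Longrightarrow> vanishes p (\<lambda>h. \<Sum>i\<in>I. f i h)"
  by (induction I rule: infinite_finite_induct) (auto intro: vanishes_zero vanishes_add)

lemma vanishes_uminus: "vanishes p f \<Longrightarrow> vanishes p (\<lambda>h. - f h)"
  by (simp add: vanishes_def)

lemma vanishes_mult:
  fixes f g :: "real \<Rightarrow> 'a::real_normed_field"
  assumes "vanishes p f" "(g \<longlongrightarrow> l) (at 0)"
  shows "vanishes p (\<lambda>h. f h * g h)"
proof -
  obtain C where C: "\<forall>\<^sub>F h in at 0. norm (f h) \<le> C * \<bar>h\<bar> ^ p" using assms(1) by (auto simp: vanishes_def)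
  have "\<forall>\<^sub>F h in at 0. norm (g h) < norm l + 1"
    by (rule order_tendstoD(2)[OF tendsto_norm[OF assms(2)]]) simp
  with C have "\<forall>\<^sub>F h in at 0. norm (f h * g h) \<le> (C * (norm l + 1)) * \<bar>h\<bar> ^ p"
  proof eventually_elim
    case (elim h)
    have "norm (f h) * norm (g h) \<le> (C * \<bar>h\<bar> ^ p) * (norm l + 1)"
      by (rule mult_mono) (use elim order_trans[OF norm_ge_zero elim(1)] in auto)
    then show ?case by (simp add: norm_mult mult_ac)
  qed
  then show ?thesis by (auto simp: vanishes_def)
qed

lemma vanishes_divide:
  fixes f g :: "real \<Rightarrow> complex"
  assumes f: "vanishes (Suc p) f" and g: "\<forall>\<^sub>F h in at 0. f h = of_real h * g h"
  shows "vanishes p g"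
proof -
  obtain C where "\<forall>\<^sub>F h in at 0. norm (f h) \<le> C * \<bar>h\<bar> ^ Suc p" using f by (auto simp: vanishes_def)
  moreover have "\<forall>\<^sub>F h in at 0. h \<noteq> (0::real)" by (simp add: eventually_at_filter)
  ultimately have "\<forall>\<^sub>F h in at 0. norm (g h) \<le> C * \<bar>h\<bar> ^ p"
    using g
  proof eventually_elim
    case (elim h)
    then have "\<bar>h\<bar> * norm (g h) \<le> \<bar>h\<bar> * (C * \<bar>h\<bar> ^ p)" by (simp add: norm_mult mult_ac)
    with elim show ?case by (simp add: mult_le_cancel_left)
  qed
  then show ?thesis by (auto simp: vanishes_def)
qed

lemma vanishes_tendsto_0:
  assumes "vanishes p f" "p \<ge> 1"
  shows "(f \<longlongrightarrow> 0) (at 0)"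
proof -
  obtain C where C: "\<forall>\<^sub>F h in at 0. norm (f h) \<le> C * \<bar>h\<bar> ^ p" using assms(1) by (auto simp: vanishes_def)
  have "((\<lambda>h::real. C * \<bar>h\<bar> ^ p) \<longlongrightarrow> C * \<bar>0\<bar> ^ p) (at 0)" by (intro tendsto_intros)
  moreover have "C * \<bar>0::real\<bar> ^ p = 0" using assms(2) by (simp add: power_0_left)
  ultimately have "((\<lambda>h::real. C * \<bar>h\<bar> ^ p) \<longlongrightarrow> 0) (at 0)" by (rule tendsto_eq_rhs)
  with C show ?thesis by (rule Lim_null_comparison)
qed

lemma norm_vec_le_sum: "norm x \<le> (\<Sum>i\<in>UNIV. norm (x $ i))"
  unfolding norm_vec_def by (rule L2_set_le_sum) simp

lemma vanishes_vec_iff: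
  fixes f :: "real \<Rightarrow> 'a::real_normed_vector ^ 'm::finite"
  shows "vanishes p f \<longleftrightarrow> (\<forall>i. vanishes p (\<lambda>h. f h $ i))"
proof
  assume "vanishes p f"
  then show "\<forall>i. vanishes p (\<lambda>h. f h $ i)"
    by (auto intro: vanishes_le simp: Finite_Cartesian_Product.norm_nth_le)
next
  assume "\<forall>i. vanishes p (\<lambda>h. f h $ i)"
  then have "vanishes p (\<lambda>h. \<Sum>i\<in>UNIV. norm (f h $ i))"
    by (intro vanishes_sum) (simp add: vanishes_def)
  then show "vanishes p f"
    by (rule vanishes_le) (simp add: order_trans[OF norm_vec_le_sum abs_ge_self])
qed

lemma vanishes_matrix_mult:
  fixes X :: "real \<Rightarrow> complex ^ 'm::finite ^ 'm"
  assumes "vanishes p X"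
  shows "vanishes p (\<lambda>h. A ** X h ** B)"
  using assms unfolding vanishes_vec_iff matrix_matrix_mult_def
  by (auto intro!: vanishes_sum vanishes_mult[OF _ tendsto_const] simp: mult.commute[of "A $ _ $ _"])

lemma vanishes_mult_diff:
  fixes f g :: "real \<Rightarrow> 'a::real_normed_field"
  assumes f: "vanishes p (\<lambda>h. f h - f0)" and g: "vanishes p (\<lambda>h. g h - g0)" "(g \<longlongrightarrow> g0) (at 0)"
  shows "vanishes p (\<lambda>h. f h * g h - f0 * g0)"
proof -
  have "vanishes p (\<lambda>h. (f h - f0) * g h + (g h - g0) * f0)"
    by (intro vanishes_add vanishes_mult[OF f g(2)] vanishes_mult[OF g(1) tendsto_const])
  then show ?thesis by (simp add: algebra_simps)
qed

lemma exp_quotient_tendsto: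
  "((\<lambda>h. (exp (\<i> * of_real (h * a)) - 1) / of_real h) \<longlongrightarrow> \<i> * of_real a) (at 0)"
proof -
  have "((\<lambda>h. h *\<^sub>R (\<i> * of_real a)) has_vector_derivative \<i> * of_real a) (at 0)"
    by (auto intro!: derivative_eq_intros)
  then have "((\<lambda>h. \<i> * of_real a * of_real h) has_vector_derivative \<i> * of_real a) (at 0)"
    by (simp add: scaleR_conv_of_real mult.commute)
  from field_vector_diff_chain_at[OF this, of exp 1]
  have "((\<lambda>h. exp (\<i> * of_real a * of_real h)) has_vector_derivative \<i> * of_real a) (at 0)"
    using DERIV_exp[of "0::complex"] by (simp add: o_def)
  then show ?thesis by (simp add: has_vector_derivative_iff_quotient mult_ac)
qed

text \<open>
  Close to \<open>1\<close> the logarithm is Lipschitz, so a small angle is bounded by a multiple of the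
  corresponding chord.
\<close>

lemma angle_vanishes:
  fixes x :: "real \<Rightarrow> real"
  assumes x: "(x \<longlongrightarrow> 0) (at 0)" and e: "vanishes p (\<lambda>h. exp (\<i> * of_real (x h)) - 1)"
  shows "vanishes p (\<lambda>h. complex_of_real (x h))"
proof -
  have "((\<lambda>h. norm (exp (\<i> * of_real (x h)) - 1)) \<longlongrightarrow> norm (exp (\<i> * of_real 0) - 1 :: complex)) (at 0)"
    by (intro tendsto_intros x)
  then have "\<forall>\<^sub>F h in at 0. norm (exp (\<i> * of_real (x h)) - 1) < 1 / 2"
    by (rule order_tendstoD) simp
  moreover have "\<forall>\<^sub>F h in at 0. \<bar>x h\<bar> < 1"
    using order_tendstoD(2)[OF tendsto_rabs[OF x], of 1] by simp
  ultimately have "\<forall>\<^sub>F h in at 0. norm (complex_of_real (x h)) \<le> norm (2 * (exp (\<i> * of_real (x h)) - 1))"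
  proof eventually_elim
    case (elim h)
    let ?w = "\<i> * complex_of_real (x h)"
    have "Ln (exp ?w) = ?w" by (rule Ln_exp) (use elim(2) pi_gt3 in auto)
    then have "norm ?w = norm (Ln (1 + (exp ?w - 1)))" by simp
    also have "\<dots> \<le> 2 * norm (exp ?w - 1)" by (rule norm_Ln_le[OF elim(1)])
    finally show ?case by (simp only: norm_mult norm_ii norm_of_real norm_numeral mult_1_left)
  qed
  moreover have "vanishes p (\<lambda>h. 2 * (exp (\<i> * of_real (x h)) - 1))"
    using vanishes_add[OF e e] by simp
  ultimately show ?thesis by (rule vanishes_le[rotated])
qed

section \<open>Symplectic matrices\<close>

lemma sum_UNIV_Plus: "(\<Sum>i\<in>(UNIV::('a::finite + 'b::finite) set). f i) = (\<Sum>k\<in>UNIV. f (Inl k)) + (\<Sum>k\<in>UNIV. f (Inr k))"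
  by (simp add: UNIV_Plus_UNIV[symmetric] sum.Plus del: UNIV_Plus_UNIV)

text \<open>
  The bilinear form \<open>u\<^sup>T J v\<close>, without complex conjugation.
\<close>

definition symp_form :: "'a::comm_ring_1 ^ ('n::finite + 'n) \<Rightarrow> 'a ^ ('n + 'n) \<Rightarrow> 'a" where
  "symp_form u v = (\<Sum>k\<in>UNIV. u $ Inl k * v $ Inr k - u $ Inr k * v $ Inl k)"

lemma J_mat_mult_vec:
  fixes v :: "'a::comm_ring_1 ^ ('n::finite + 'n)"
  shows "(J_mat *v v) $ i = (case i of Inl k \<Rightarrow> v $ Inr k | Inr k \<Rightarrow> - (v $ Inl k))"
  by (cases i) (simp_all add: matrix_vector_mult_def J_mat_def sum_UNIV_Plus if_distrib if_distribR
      cong: if_cong)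

lemma symp_form_conv: "symp_form u v = (\<Sum>i\<in>UNIV. u $ i * (J_mat *v v) $ i)"
  by (simp add: symp_form_def sum_UNIV_Plus J_mat_mult_vec sum_subtractf sum_negf)

lemma sum_matrix_vector_transpose:
  fixes A :: "'a::comm_ring_1 ^ 'm::finite ^ 'm"
  shows "(\<Sum>i\<in>UNIV. (A *v u) $ i * w $ i) = (\<Sum>j\<in>UNIV. u $ j * (transpose A *v w) $ j)"
  by (simp add: matrix_vector_mult_def transpose_def sum_distrib_left sum_distrib_right mult_ac)
     (rule sum.swap)

lemma symplectic_preserves_form:
  assumes "symplectic S"
  shows "symp_form (S *v u) (S *v v) = symp_form u v"
proof -
  have "transpose S *v (J_mat *v (S *v v)) = J_mat *v v"
    using assms by (simp add: symplectic_def matrix_vector_mul_assoc matrix_mul_assoc)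
  then show ?thesis by (simp add: symp_form_conv sum_matrix_vector_transpose)
qed

lemma transpose_mult_vec_nth: "(transpose A *v w) $ i = (\<Sum>j\<in>UNIV. A $ j $ i * w $ j)"
  by (simp add: matrix_vector_mult_def transpose_def)

lemma symplectic_iff_columns:
  fixes M :: "('a::comm_ring_1, 'n::finite) block_matrix"
  shows "symplectic M \<longleftrightarrow> (\<forall>i j. symp_form (column i M) (column j M) = J_mat $ i $ j)"
proof -
  have "(transpose M ** J_mat ** M) $ i $ j = symp_form (column i M) (column j M)" for i j
  proof -
    have "(transpose M ** J_mat ** M) $ i $ j = (transpose M *v (J_mat *v column j M)) $ i"
      by (simp only: matrix_mult_nth_column matrix_vector_mul_assoc)
    also have "\<dots> = (\<Sum>k\<in>UNIV. M $ k $ i * (J_mat *v column j M) $ k)"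
      by (rule transpose_mult_vec_nth)
    also have "\<dots> = symp_form (column i M) (column j M)"
      by (simp only: symp_form_conv column_def vec_lambda_beta)
    finally show ?thesis .
  qed
  then show ?thesis by (auto simp: symplectic_def vec_eq_iff)
qed

lemma J_mat_square: "J_mat ** J_mat = - (mat 1 :: ('a::comm_ring_1, 'n::finite) block_matrix)"
proof -
  have "(J_mat ** J_mat) $ i $ j = (- mat 1 :: ('a, 'n) block_matrix) $ i $ j" for i j
    unfolding matrix_mult_nth_column J_mat_mult_vec column_def
    by (cases i; cases j) (auto simp: J_mat_def mat_def)
  then show ?thesis by (simp add: vec_eq_iff)
qed

text \<open>
  For a symplectic matrix this is the inverse.  The explicit formula is polynomial in the entries, so
  smoothness and orders of vanishing carry over from a matrix to its inverse.
\<close>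

definition symp_inv :: "('a::field, 'n::finite) block_matrix \<Rightarrow> ('a, 'n) block_matrix" where
  "symp_inv M = - (J_mat ** transpose M ** J_mat)"

lemma minus_matrix_mult: "(- A) ** B = - (A ** B)" for A :: "'a::ring_1 ^ 'm::finite ^ 'm"
  by (simp add: matrix_matrix_mult_def vec_eq_iff sum_negf)

lemma matrix_mult_minus: "A ** (- B) = - (A ** B)" for A :: "'a::ring_1 ^ 'm::finite ^ 'm"
  by (simp add: matrix_matrix_mult_def vec_eq_iff sum_negf)

lemma symp_inv:
  assumes "symplectic M"
  shows "symp_inv M ** M = mat 1" "M ** symp_inv M = mat 1"
proof -
  have "symp_inv M ** M = - (J_mat ** (transpose M ** J_mat ** M))"
    by (simp add: symp_inv_def minus_matrix_mult matrix_mul_assoc)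
  then show "symp_inv M ** M = mat 1"
    using assms by (simp add: symplectic_def J_mat_square)
  then show "M ** symp_inv M = mat 1" using matrix_left_right_inverse by blast
qed

lemma matrix_inv_unique:
  fixes A B :: "'a::field ^ 'm::finite ^ 'm"
  assumes "A ** B = mat 1" "B ** A = mat 1"
  shows "matrix_inv A = B"
proof -
  have "A ** matrix_inv A = mat 1 \<and> matrix_inv A ** A = mat 1"
    unfolding matrix_inv_def by (rule someI[of _ B]) (use assms in simp)
  then show ?thesis by (metis assms(2) matrix_mul_assoc matrix_mul_lid matrix_mul_rid)
qed

lemma symplectic_mult: "symplectic A \<Longrightarrow> symplectic B \<Longrightarrow> symplectic (A ** B)"
  for A B :: "('a::comm_ring_1, 'n::finite) block_matrix"
  by (simp add: symplectic_def matrix_transpose_mul matrix_mul_assoc)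
     (metis matrix_mul_assoc)

lemma symplectic_symp_inv:
  fixes M :: "('a::field, 'n::finite) block_matrix"
  assumes "symplectic M"
  shows "symplectic (symp_inv M)"
proof -
  let ?N = "symp_inv M"
  have "transpose ?N ** transpose M = mat 1"
    by (simp add: matrix_transpose_mul[symmetric] symp_inv(2)[OF assms] transpose_mat)
  then have "J_mat = transpose ?N ** transpose M ** J_mat ** (M ** ?N)"
    by (simp add: symp_inv(2)[OF assms])
  also have "\<dots> = transpose ?N ** (transpose M ** J_mat ** M) ** ?N"
    by (simp add: matrix_mul_assoc)
  finally show ?thesis using assms by (simp add: symplectic_def)
qed

lemma complex_mat_mult: "complex_mat (A ** B) = complex_mat A ** complex_mat B"
  by (simp add: complex_mat_def matrix_matrix_mult_def vec_eq_iff)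

lemma symplectic_complex_mat:
  fixes P :: "(real, 'n::finite) block_matrix"
  assumes "symplectic P"
  shows "symplectic (complex_mat P)"
proof -
  have J: "complex_mat (J_mat :: (real, 'n) block_matrix) = J_mat"
    by (auto simp: complex_mat_def J_mat_def vec_eq_iff split: sum.split)
  have "complex_mat (transpose P ** J_mat ** P) = complex_mat (J_mat :: (real, 'n) block_matrix)"
    using assms by (simp add: symplectic_def)
  moreover have "complex_mat (transpose P) = transpose (complex_mat P)"
    by (simp add: complex_mat_def transpose_def vec_eq_iff)
  ultimately show ?thesis by (simp add: symplectic_def complex_mat_mult J)
qed

lemma symp_form_scale: "symp_form (a *s u) (b *s v) = a * b * symp_form u v"
  by (simp add: symp_form_def sum_distrib_left algebra_simps)

lemma symp_form_skew: "symp_form v u = - symp_form u v"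
  by (simp add: symp_form_def mult.commute flip: sum_negf)

lemma symplectic_mat_1: "symplectic (mat 1)"
  by (simp add: symplectic_def transpose_mat)

section \<open>The flow of a diagonal Hamiltonian\<close>

text \<open>
  The frequencies attached to the \<open>2N\<close> eigenvectors: \<open>\<omega>\<^sub>k\<close> and its negative.  Non-resonance is
  injectivity of this function.
\<close>

definition freq :: "real ^ 'n \<Rightarrow> 'n + 'n \<Rightarrow> real" where
  "freq \<omega> = case_sum (\<lambda>k. \<omega> $ k) (\<lambda>k. - \<omega> $ k)"

text \<open>
  The flow of \<open>J D\<^sub>\<omega>\<close> in coordinates with respect to \<open>eigenbasis\<close>.
\<close>

definition flow_diag :: "real \<Rightarrow> real ^ 'n::finite \<Rightarrow> (complex, 'n) block_matrix" where
  "flow_diag h \<omega> = diag_mat (\<lambda>i. exp (\<i> * of_real (h * freq \<omega> i)))"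

text \<open>
  The columns are multiples of \<open>e\<^sub>k + \<i> f\<^sub>k\<close> and \<open>e\<^sub>k - \<i> f\<^sub>k\<close>, which span the eigenspaces of
  \<open>J D\<^sub>\<omega>\<close> for \<open>\<plusminus>\<i> \<omega>\<^sub>k\<close>.  Their symplectic product is \<open>-2 \<i>\<close>; the scalar \<open>(1 + \<i>) / 2\<close>, whose
  square is \<open>\<i> / 2\<close>, makes it \<open>1\<close>, so that the matrix is symplectic.
\<close>

definition eigenbasis :: "(complex, 'n::finite) block_matrix" where
  "eigenbasis = (\<chi> i j. (1 + \<i>) / 2 * (case (i, j) of
      (Inl k, Inl l) \<Rightarrow> if k = l then 1 else 0
    | (Inl k, Inr l) \<Rightarrow> if k = l then 1 else 0
    | (Inr k, Inl l) \<Rightarrow> if k = l then \<i> else 0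
    | (Inr k, Inr l) \<Rightarrow> if k = l then - \<i> else 0))"

definition rotation :: "real \<Rightarrow> real ^ 'n::finite \<Rightarrow> (real, 'n) block_matrix" where
  "rotation h \<omega> = (\<chi> i j. case (i, j) of
      (Inl k, Inl l) \<Rightarrow> if k = l then cos (h * \<omega> $ k) else 0
    | (Inl k, Inr l) \<Rightarrow> if k = l then sin (h * \<omega> $ k) else 0
    | (Inr k, Inl l) \<Rightarrow> if k = l then - sin (h * \<omega> $ k) else 0
    | (Inr k, Inr l) \<Rightarrow> if k = l then cos (h * \<omega> $ k) else 0)"

lemma symplectic_eigenbasis: "symplectic (eigenbasis :: (complex, 'n::finite) block_matrix)"
proof -
  have c: "((1 + \<i>) / 2) * ((1 + \<i>) / 2) = \<i> / 2" by (simp add: complex_eq_iff)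
  have "symp_form (column i eigenbasis) (column j eigenbasis) = (J_mat :: (complex, 'n) block_matrix) $ i $ j" for i j
  proof -
    have "symp_form (column i eigenbasis) (column j eigenbasis) = (\<Sum>k\<in>(UNIV :: 'n set).
       (if i = Inl k \<and> j = Inr k then 1 else 0) - (if i = Inr k \<and> j = Inl k then 1 else 0))"
      unfolding symp_form_def
      by (intro sum.cong refl, cases i; cases j)
         (auto simp: column_def eigenbasis_def complex_eq_iff)
    also have "\<dots> = J_mat $ i $ j"
      unfolding sum_subtractf by (cases i; cases j) (auto simp: J_mat_def intro!: sum.neutral)
    finally show ?thesis .
  qed
  then show ?thesis by (simp add: symplectic_iff_columns)
qed

lemma rotation_eigenbasis: "complex_mat (rotation h \<omega>) ** eigenbasis = eigenbasis ** flow_diag h \<omega>"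
proof -
  have e: "exp (\<i> * of_real x) = of_real (cos x) + \<i> * of_real (sin x)" for x
    by (simp add: cis_conv_exp[symmetric] complex_eq_iff)
  have R: "(complex_mat (rotation h \<omega>) ** eigenbasis) $ i $ j = (case i of
      Inl k \<Rightarrow> cos (h * \<omega> $ k) * eigenbasis $ Inl k $ j + sin (h * \<omega> $ k) * eigenbasis $ Inr k $ j
    | Inr k \<Rightarrow> - sin (h * \<omega> $ k) * eigenbasis $ Inl k $ j + cos (h * \<omega> $ k) * eigenbasis $ Inr k $ j)" for i j
    by (cases i) (simp_all add: matrix_matrix_mult_def complex_mat_def rotation_def sum_UNIV_Plus
      if_distrib[of complex_of_real] if_distrib[of "\<lambda>x. x * _"] cong: if_cong)
  have F: "(eigenbasis ** flow_diag h \<omega>) $ i $ j = eigenbasis $ i $ j * exp (\<i> * of_real (h * freq \<omega> j))" for i j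
    by (simp add: flow_diag_def mult_diag_mat)
  have "(complex_mat (rotation h \<omega>) ** eigenbasis) $ i $ j = (eigenbasis ** flow_diag h \<omega>) $ i $ j" for i j
    unfolding R F e
    by (cases i; cases j) (auto simp: eigenbasis_def freq_def complex_eq_iff algebra_simps)
  then show ?thesis by (simp add: vec_eq_iff)
qed

lemma matrix_mult_scaleR: "A ** (k *\<^sub>R B) = k *\<^sub>R (A ** B)"
  for A :: "'a::real_algebra_1 ^ 'm::finite ^ 'l::finite" and B :: "'a ^ 'n::finite ^ 'm"
  by (simp add: matrix_scalar_ac scalar_matrix_assoc)

lemma add_matrix_mult: "(A + B) ** C = A ** C + B ** C"
  for A B :: "'a::semiring_1 ^ 'm::finite ^ 'l::finite" and C :: "'a ^ 'n::finite ^ 'm"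
  by (simp add: matrix_matrix_mult_def vec_eq_iff sum.distrib distrib_right)

lemma mat_power_Suc: "mat_power A (Suc n) = A ** mat_power A n"
  by (simp add: mat_power_def)

text \<open>
  The \<open>n\<close>-th term of the exponential series, written with the Taylor coefficients of cosine and
  sine; multiplying by \<open>J D\<^sub>\<omega>\<close> interchanges the two exactly as differentiation does.
\<close>

lemma mat_power_rotation_generator:
  "mat_power (h *\<^sub>R (J_mat ** D_mat \<omega>)) n /\<^sub>R fact n = (\<chi> i j. case (i, j) of
      (Inl k, Inl l) \<Rightarrow> if k = l then cos_coeff n * (h * \<omega> $ k) ^ n else 0
    | (Inl k, Inr l) \<Rightarrow> if k = l then sin_coeff n * (h * \<omega> $ k) ^ n else 0
    | (Inr k, Inl l) \<Rightarrow> if k = l then - sin_coeff n * (h * \<omega> $ k) ^ n else 0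
    | (Inr k, Inr l) \<Rightarrow> if k = l then cos_coeff n * (h * \<omega> $ k) ^ n else 0)"
  (is "?L n = ?R n")
proof (induction n)
  case 0
  show ?case by (auto simp: mat_power_def mat_def vec_eq_iff cos_coeff_def sin_coeff_def split: sum.split)
next
  case (Suc n)
  define A where "A = h *\<^sub>R (J_mat ** D_mat \<omega>)"
  have A: "(A ** X) $ i $ j = (case i of Inl k \<Rightarrow> h * \<omega> $ k * X $ Inr k $ j
      | Inr k \<Rightarrow> - (h * \<omega> $ k) * X $ Inl k $ j)" for X :: "(real, 'a) block_matrix" and i j
  proof -
    have "(A ** X) $ i $ j = h * (J_mat *v (D_mat \<omega> *v column j X)) $ i"
      by (simp only: A_def scalar_matrix_assoc[symmetric] matrix_mult_nth_column
         matrix_vector_mul_assoc vector_scaleR_component real_scaleR_def)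
    moreover have "(D_mat \<omega> *v w) $ i = freq \<omega> i * (case i of Inl _ \<Rightarrow> 1 | Inr _ \<Rightarrow> -1) * w $ i" for w i
      by (cases i) (simp_all add: matrix_vector_mult_def D_mat_def freq_def if_distrib if_distribR cong: if_cong)
    ultimately show ?thesis
      by (cases i) (simp_all add: J_mat_mult_vec column_def freq_def)
  qed
  have "?L (Suc n) = (1 / real (Suc n)) *\<^sub>R (A ** ?L n)"
    by (simp add: A_def mat_power_Suc matrix_mult_scaleR mult.commute divide_inverse)
  also have "\<dots> = (1 / real (Suc n)) *\<^sub>R (A ** ?R n)" by (simp only: Suc)
  also have "\<dots> = ?R (Suc n)"
    by (auto simp: vec_eq_iff A cos_coeff_Suc sin_coeff_Suc divide_inverse mult_ac
        simp del: of_nat_Suc split: sum.split)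
  finally show ?case .
qed

lemma sums_vec:
  fixes f :: "nat \<Rightarrow> 'a::real_normed_vector ^ 'm::finite"
  assumes "\<And>i. (\<lambda>n. f n $ i) sums (s $ i)"
  shows "f sums s"
  unfolding sums_def
  by (rule vec_tendstoI) (use assms in \<open>simp add: sums_def sum_component\<close>)

lemma rotation_sums:
  "(\<lambda>n. mat_power (h *\<^sub>R (J_mat ** D_mat \<omega>)) n /\<^sub>R fact n) sums rotation h \<omega>"
proof -
  have c: "(\<lambda>n. cos_coeff n * x ^ n) sums cos x" and s: "(\<lambda>n. sin_coeff n * x ^ n) sums sin x" for x :: real
    using cos_converges[of x] sin_converges[of x] by simp_all
  have m: "(\<lambda>n. - (sin_coeff n * x ^ n)) sums - sin x" for x :: real
    by (rule sums_minus[OF s])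
  show ?thesis
    unfolding mat_power_rotation_generator
    by (intro sums_vec) (auto simp: rotation_def c s m split: sum.split)
qed

lemma mat_exp_rotation: "mat_exp (h *\<^sub>R (J_mat ** D_mat \<omega>)) = rotation h \<omega>"
  unfolding mat_exp_def by (rule sums_unique[OF rotation_sums, symmetric])

lemma mat_power_conj:
  fixes P Q A :: "real ^ 'm::finite ^ 'm"
  assumes "P ** Q = mat 1" "Q ** P = mat 1"
  shows "mat_power (Q ** A ** P) n = Q ** mat_power A n ** P"
proof (induction n)
  case 0
  then show ?case by (simp add: mat_power_def assms)
next
  case (Suc n)
  have "mat_power (Q ** A ** P) (Suc n) = Q ** A ** (P ** Q) ** mat_power A n ** P"
    by (simp only: mat_power_Suc Suc matrix_mul_assoc)
  then show ?case by (simp add: assms mat_power_Suc matrix_mul_assoc)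
qed

lemma mat_exp_conj_rotation:
  fixes P Q :: "(real, 'n::finite) block_matrix"
  assumes "P ** Q = mat 1" "Q ** P = mat 1"
  shows "mat_exp (h *\<^sub>R (Q ** (J_mat ** D_mat \<omega>) ** P)) = Q ** rotation h \<omega> ** P"
proof -
  let ?A = "h *\<^sub>R (J_mat ** D_mat \<omega>) :: (real, 'n) block_matrix"
  have c: "h *\<^sub>R (Q ** (J_mat ** D_mat \<omega>) ** P) = Q ** ?A ** P"
    by (simp add: matrix_mult_scaleR flip: scalar_matrix_assoc)
  have lin: "bounded_linear (\<lambda>X. Q ** X ** P)"
    unfolding linear_conv_bounded_linear[symmetric]
    by (rule linearI) (simp_all add: matrix_add_ldistrib add_matrix_mult matrix_scalar_ac scalar_matrix_assoc)
  have "(\<lambda>n. Q ** (mat_power ?A n /\<^sub>R fact n) ** P) sums (Q ** rotation h \<omega> ** P)"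
    by (rule bounded_linear.sums[OF lin rotation_sums])
  moreover have "Q ** (mat_power ?A n /\<^sub>R fact n) ** P = mat_power (Q ** ?A ** P) n /\<^sub>R fact n" for n
    using linear_scale[OF bounded_linear.linear[OF lin], of "inverse (fact n)" "mat_power ?A n"]
    by (simp add: mat_power_conj[OF assms])
  ultimately show ?thesis unfolding mat_exp_def c by (simp add: sums_iff)
qed

text \<open>
  The index of the opposite frequency.
\<close>

fun partner :: "'n + 'n \<Rightarrow> 'n + 'n" where
  "partner (Inl k) = Inr k"
| "partner (Inr k) = Inl k"

lemma freq_partner: "freq \<omega> (partner i) = - freq \<omega> i"
  by (cases i) (simp_all add: freq_def)

lemma J_mat_nonpartner: "j \<noteq> partner i \<Longrightarrow> J_mat $ i $ j = 0"
  by (cases i; cases j) (auto simp: J_mat_def)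

section \<open>Symplectic diagonalisation of a perturbed flow\<close>

text \<open>
  Row \<open>i\<close> of the eigenvector equation for column \<open>j\<close> reads
  \<open>(1 + h \<mu>\<^sub>j - exp (\<i> h f\<^sub>i)) V\<^sub>i\<^sub>j = R\<^sub>i\<^sub>j\<close>, where \<open>R\<close> is the perturbation applied to a bounded vector.
  For \<open>i = j\<close> this estimates the eigenvalue.  For \<open>i \<noteq> j\<close> the factor is \<open>h\<close> times a function with
  the nonzero limit \<open>\<i> (f\<^sub>j - f\<^sub>i)\<close>, and dividing by it costs one order.
\<close>

lemma vanishes_of_nonresonant_perturbation:
  fixes V :: "real \<Rightarrow> complex ^ 'm::finite ^ 'm" and G :: "real \<Rightarrow> complex ^ 'm ^ 'm"
  assumes E: "vanishes (Suc p) (\<lambda>h. G h - diag_mat (\<lambda>i. exp (\<i> * of_real (h * f i))))"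
    and V: "\<And>i j. ((\<lambda>h. V h $ i $ j) \<longlongrightarrow> V0 $ i $ j) (at 0)"
    and \<mu>: "\<And>j. (\<mu> j \<longlongrightarrow> \<i> * of_real (f j)) (at 0)" and f: "inj f"
    and eig: "\<forall>\<^sub>F h in at 0. \<forall>j. G h *v column j (V h) = (1 + of_real h * \<mu> j h) *s column j (V h)
        \<and> V h $ j $ j = 1"
  shows "vanishes p (\<lambda>h. V h - mat 1)"
    and "vanishes (Suc p) (\<lambda>h. 1 + of_real h * \<mu> j h - exp (\<i> * of_real (h * f j)))"
proof -
  define R where "R i j h = (\<Sum>l\<in>UNIV. (G h - diag_mat (\<lambda>i. exp (\<i> * of_real (h * f i)))) $ i $ l * V h $ l $ j)"
    for i j and h :: real
  have R: "vanishes (Suc p) (R i j)" for i j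
    unfolding R_def using E by (auto simp: vanishes_vec_iff intro!: vanishes_sum vanishes_mult[OF _ V])
  have row: "\<forall>\<^sub>F h in at 0. R i j h = (1 + of_real h * \<mu> j h - exp (\<i> * of_real (h * f i))) * V h $ i $ j"
    for i j using eig
  proof eventually_elim
    case (elim h)
    have "R i j h = ((G h - diag_mat (\<lambda>i. exp (\<i> * of_real (h * f i)))) *v column j (V h)) $ i"
      by (simp add: R_def matrix_vector_mult_def column_def)
    also have "\<dots> = (G h *v column j (V h)) $ i - exp (\<i> * of_real (h * f i)) * V h $ i $ j"
      by (simp add: matrix_vector_mult_diff_rdistrib diag_mat_mult_vec column_def)
    also have "(G h *v column j (V h)) $ i = ((1 + of_real h * \<mu> j h) *s column j (V h)) $ i"
      using elim by metis
    also have "\<dots> = (1 + of_real h * \<mu> j h) * V h $ i $ j"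
      by (simp only: vector_smult_component column_def vec_lambda_beta)
    finally show ?case by (simp only: left_diff_distrib)
  qed
  have "\<forall>\<^sub>F h in at 0. norm (R j j h) = norm (1 + of_real h * \<mu> j h - exp (\<i> * of_real (h * f j)))"
    using row[of j j] eig by eventually_elim simp
  from vanishes_cong[OF this] R[of j j]
  show "vanishes (Suc p) (\<lambda>h. 1 + of_real h * \<mu> j h - exp (\<i> * of_real (h * f j)))" by simp
  have "vanishes p (\<lambda>h. V h $ i $ j - mat 1 $ i $ j)" for i j
  proof (cases "i = j")
    case True
    have "\<forall>\<^sub>F h in at 0. norm (V h $ i $ j - mat 1 $ i $ j) = norm (0 :: complex)"
      using eig by eventually_elim (simp add: True mat_def)
    from vanishes_cong[OF this] show ?thesis by (simp add: vanishes_zero)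
  next
    case False
    define c where "c h = \<mu> j h - (exp (\<i> * of_real (h * f i)) - 1) / of_real h" for h :: real
    have lim: "(c \<longlongrightarrow> \<i> * of_real (f j) - \<i> * of_real (f i)) (at 0)"
      unfolding c_def by (intro tendsto_intros \<mu> exp_quotient_tendsto)
    have nz: "\<i> * of_real (f j) - \<i> * of_real (f i) \<noteq> (0 :: complex)"
      using f False by (auto simp: inj_eq simp flip: right_diff_distrib of_real_diff)
    have ne: "\<forall>\<^sub>F h in at 0. h \<noteq> (0::real)" by (simp add: eventually_at_filter)
    have "\<forall>\<^sub>F h in at 0. R i j h = of_real h * (c h * V h $ i $ j)"
      using row[of i j] ne
    proof eventually_elim
      case (elim h)
      have "1 + of_real h * \<mu> j h - exp (\<i> * of_real (h * f i)) = of_real h * c h"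
        using elim(2) by (simp add: c_def field_simps)
      with elim(1) show ?case by (simp only: mult.assoc)
    qed
    from vanishes_divide[OF R this] have "vanishes p (\<lambda>h. c h * V h $ i $ j * inverse (c h))"
      by (rule vanishes_mult[OF _ tendsto_inverse[OF lim nz]])
    moreover have "\<forall>\<^sub>F h in at 0. norm (c h * V h $ i $ j * inverse (c h)) = norm (V h $ i $ j - mat 1 $ i $ j)"
      using tendsto_imp_eventually_ne[OF lim nz] by eventually_elim (simp add: mat_def False norm_mult norm_inverse)
    ultimately show ?thesis by (rule vanishes_cong[THEN iffD1, rotated])
  qed
  then show "vanishes p (\<lambda>h. V h - mat 1)" by (simp add: vanishes_vec_iff)
qed

text \<open>
  The core of the argument, in the coordinates in which the unperturbed flow is diagonal.  The
  interval shrinks a single time, to a neighbourhood of \<open>0\<close> where finitely many continuous functions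
  that are nonzero at \<open>0\<close> remain nonzero.
\<close>

lemma symplectic_diagonalisation:
  fixes G :: "real \<Rightarrow> (complex, 'n::finite) block_matrix" and \<omega> :: "real ^ 'n"
  assumes G: "smooth_on UNIV G" and symp: "\<And>h. symplectic (G h)"
    and spec: "\<And>h. spectrum (G h) = cnj ` spectrum (G h)"
    and p: "p \<ge> 1" and E: "vanishes (Suc p) (\<lambda>h. G h - flow_diag h \<omega>)" and \<omega>: "non_resonant \<omega>"
  obtains \<delta> M \<theta> where "\<delta> > 0" "smooth_on {-\<delta><..<\<delta>} M" "smooth_on {-\<delta><..<\<delta>} \<theta>"
    "\<And>h. \<bar>h\<bar> < \<delta> \<Longrightarrow> symplectic (M h)"
    "\<And>h. \<bar>h\<bar> < \<delta> \<Longrightarrow> G h ** M h = M h ** flow_diag h (\<theta> h)"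
    "vanishes p (\<lambda>h. M h - mat 1)" "vanishes p (\<lambda>h. \<theta> h - \<omega>)"
proof -
  define d where "d i = \<i> * complex_of_real (freq \<omega> i)" for i
  have inj: "inj (freq \<omega>)" using \<omega> by (simp add: non_resonant_def freq_def)
  have d: "inj d" using inj by (auto simp: d_def inj_def)
  have d_partner: "d i + d j = 0 \<longleftrightarrow> j = partner i" for i j
  proof -
    have "d i + d j = 0 \<longleftrightarrow> freq \<omega> j = freq \<omega> (partner i)"
      by (auto simp: d_def freq_partner complex_eq_iff)
    then show ?thesis using inj by (simp add: inj_eq)
  qed
  have cnj_d: "cnj (d i) = d j \<longleftrightarrow> j = partner i" for i j
  proof -
    have "cnj (d i) = d j \<longleftrightarrow> d i + d j = 0" by (auto simp: d_def complex_eq_iff)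
    then show ?thesis by (simp add: d_partner)
  qed
  have Ee: "vanishes (Suc p) (\<lambda>h. G h $ i $ j - flow_diag h \<omega> $ i $ j)" for i j
    using E by (simp add: vanishes_vec_iff)
  have Ge: "smooth_on UNIV (\<lambda>h. G h $ i $ j)" for i j by (intro smooth_intros G)
  have flow_lim: "((\<lambda>h. flow_diag h \<omega> $ i $ j) \<longlongrightarrow> mat 1 $ i $ j) (at 0)" for i j
  proof -
    have "((\<lambda>h. exp (\<i> * complex_of_real (h * freq \<omega> i))) \<longlongrightarrow> exp (\<i> * complex_of_real (0 * freq \<omega> i))) (at 0)"
      by (intro tendsto_intros)
    then show ?thesis by (cases "i = j") (simp_all add: flow_diag_def diag_mat_def mat_def)
  qed
  \<comment> \<open>Both \<open>G\<close> and the diagonal flow are continuous, and their difference tends to \<open>0\<close>.\<close>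
  have "G 0 $ i $ j = mat 1 $ i $ j" for i j
  proof (rule LIM_unique)
    show "(\<lambda>h. G h $ i $ j) \<midarrow>0\<rightarrow> G 0 $ i $ j" by (rule smooth_on_tendsto[OF Ge]) simp
    have "((\<lambda>h. (G h $ i $ j - flow_diag h \<omega> $ i $ j) + flow_diag h \<omega> $ i $ j) \<longlongrightarrow> 0 + mat 1 $ i $ j) (at 0)"
      by (intro tendsto_add vanishes_tendsto_0[OF Ee] flow_lim) simp
    then show "(\<lambda>h. G h $ i $ j) \<midarrow>0\<rightarrow> mat 1 $ i $ j" by simp
  qed
  then have G0: "G 0 = mat 1" by (simp add: vec_eq_iff)
  obtain B where B: "smooth_on UNIV B" "\<And>h. G h - mat 1 = h *\<^sub>R B h"
    using hadamard_division[of UNIV "\<lambda>h. G h - mat 1"] G0 smooth_on_diff[OF G smooth_on_const] by auto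
  have Be: "smooth_on UNIV (\<lambda>h. B h $ i $ j)" for i j by (intro smooth_intros B(1))
  \<comment> \<open>The perturbation is still \<open>O(h\<^sup>p)\<close> with \<open>p \<ge> 1\<close> after division by \<open>h\<close>.\<close>
  have "B 0 $ i $ j = diag_mat d $ i $ j" for i j
  proof (rule LIM_unique)
    show "(\<lambda>h. B h $ i $ j) \<midarrow>0\<rightarrow> B 0 $ i $ j" by (rule smooth_on_tendsto[OF Be]) simp
    define e where "e h = (if i = j then (exp (\<i> * complex_of_real (h * freq \<omega> i)) - 1) / complex_of_real h else 0)" for h
    have e: "(e \<longlongrightarrow> diag_mat d $ i $ j) (at 0)"
      using exp_quotient_tendsto by (simp add: e_def[abs_def] diag_mat_def d_def)
    have "G h $ i $ j - flow_diag h \<omega> $ i $ j = of_real h * (B h $ i $ j - e h)" if "h \<noteq> 0" for h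
    proof -
      have "(G h - mat 1) $ i $ j = of_real h * B h $ i $ j"
        unfolding B(2) vector_scaleR_component by (rule scaleR_conv_of_real)
      then have "G h $ i $ j = mat 1 $ i $ j + of_real h * B h $ i $ j" by (simp add: algebra_simps)
      then show ?thesis
        using that by (simp add: e_def flow_diag_def diag_mat_def mat_def field_simps)
    qed
    then have "\<forall>\<^sub>F h in at 0. G h $ i $ j - flow_diag h \<omega> $ i $ j = of_real h * (B h $ i $ j - e h)"
      by (simp add: eventually_at_filter)
    from vanishes_tendsto_0[OF vanishes_divide[OF Ee this] p]
    have "((\<lambda>h. (B h $ i $ j - e h) + e h) \<longlongrightarrow> 0 + diag_mat d $ i $ j) (at 0)"
      using e by (rule tendsto_add)
    then show "(\<lambda>h. B h $ i $ j) \<midarrow>0\<rightarrow> diag_mat d $ i $ j" by simp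
  qed
  then have B0: "B 0 = diag_mat d" by (simp add: vec_eq_iff)
  obtain \<delta>1 \<mu> V where \<delta>1: "\<delta>1 > 0" and \<mu>_smooth: "\<And>k. smooth_on {-\<delta>1<..<\<delta>1} (\<mu> k)"
    and V_smooth: "\<And>i j. smooth_on {-\<delta>1<..<\<delta>1} (\<lambda>h. V h $ i $ j)"
    and \<mu>0: "\<And>k. \<mu> k 0 = d k" and V0: "V 0 = mat 1"
    and eigB: "\<And>h k. \<bar>h\<bar> < \<delta>1 \<Longrightarrow> B h *v column k (V h) = \<mu> k h *s column k (V h)"
    and Vkk: "\<And>h k. \<bar>h\<bar> < \<delta>1 \<Longrightarrow> V h $ k $ k = 1"
    by (fact smooth_eigenbasis[OF Be open_UNIV UNIV_I B0 d])
  let ?I = "{-\<delta>1<..<\<delta>1}"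
  have I0: "0 \<in> ?I" using \<delta>1 by simp
  define \<rho> where "\<rho> k h = 1 + complex_of_real h * \<mu> k h" for k h
  have \<rho>_smooth: "smooth_on ?I (\<rho> k)" for k
  proof -
    have "smooth_on ?I (\<lambda>h. 1 + h *\<^sub>R \<mu> k h)" by (intro smooth_intros \<mu>_smooth)
    then show ?thesis by (simp add: \<rho>_def[abs_def] scaleR_conv_of_real)
  qed
  have eigG: "G h *v column k (V h) = \<rho> k h *s column k (V h)" if "\<bar>h\<bar> < \<delta>1" for h k
  proof -
    let ?u = "column k (V h)"
    have 1: "(G h *v ?u) $ i = ((G h - mat 1) *v ?u) $ i + ?u $ i" for i
      by (simp add: matrix_vector_mult_diff_rdistrib)
    have 2: "((G h - mat 1) *v ?u) $ i = of_real h * (B h *v ?u) $ i" for i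
      unfolding B(2) matrix_vector_mult_def vec_lambda_beta vector_scaleR_component
      by (simp add: scaleR_conv_of_real sum_distrib_left mult_ac)
    have "(G h *v ?u) $ i = (\<rho> k h *s ?u) $ i" for i
      unfolding 1 2 eigB[OF that] vector_smult_component \<rho>_def by (simp only: distrib_right mult.assoc mult_1_left add.commute)
    then show ?thesis unfolding vec_eq_iff by blast
  qed
  \<comment> \<open>Symplectic products of the eigenvectors: zero unless the multipliers are inverse to each other.\<close>
  define \<Omega> where "\<Omega> i j h = symp_form (column i (V h)) (column j (V h))" for i j h
  have \<Omega>_smooth: "smooth_on ?I (\<Omega> i j)" for i j
    unfolding \<Omega>_def[abs_def] symp_form_def column_def vec_lambda_beta by (intro smooth_intros V_smooth)
  have \<Omega>0: "\<Omega> i j 0 = J_mat $ i $ j" for i j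
    unfolding \<Omega>_def V0 using symplectic_iff_columns[THEN iffD1, OF symplectic_mat_1] by blast
  have \<Omega>_eq: "(\<rho> i h * \<rho> j h - 1) * \<Omega> i j h = 0" if "\<bar>h\<bar> < \<delta>1" for i j h
    using symplectic_preserves_form[OF symp, of h "column i (V h)" "column j (V h)"]
    by (simp add: \<Omega>_def eigG[OF that] symp_form_scale left_diff_distrib)
  define c where "c i j h = \<mu> i h + \<mu> j h + h *\<^sub>R (\<mu> i h * \<mu> j h)" for i j h
  have \<rho>c: "\<rho> i h * \<rho> j h - 1 = of_real h * c i j h" for i j h
    by (simp add: \<rho>_def c_def scaleR_conv_of_real algebra_simps)
  have ev1: "\<forall>\<^sub>F h in nhds 0. j \<noteq> partner i \<longrightarrow> c i j h \<noteq> 0" for i j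
  proof (cases "j = partner i")
    case False
    have "smooth_on ?I (c i j)" unfolding c_def[abs_def] by (intro smooth_intros \<mu>_smooth)
    from smooth_on_eventually_nonzero[OF this I0] False show ?thesis
      by (simp add: c_def \<mu>0 d_partner)
  qed simp
  have ev2: "\<forall>\<^sub>F h in nhds 0. \<Omega> (Inl k) (Inr k) h \<noteq> 0" for k
    by (rule smooth_on_eventually_nonzero[OF \<Omega>_smooth I0]) (simp add: \<Omega>0 J_mat_def)
  have cnj_lin: "bounded_linear cnj" by (rule bounded_linear_cnj)
  have ev3: "\<forall>\<^sub>F h in nhds 0. j \<noteq> partner i \<longrightarrow> cnj (\<mu> i h) - \<mu> j h \<noteq> 0" for i j
  proof (cases "j = partner i")
    case False
    have "smooth_on ?I (\<lambda>h. cnj (\<mu> i h) - \<mu> j h)"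
      by (intro smooth_intros smooth_on_bounded_linear[OF cnj_lin] \<mu>_smooth)
    from smooth_on_eventually_nonzero[OF this I0] False show ?thesis
      using cnj_d[of i j] by (simp add: \<mu>0)
  qed simp
  have ev4: "\<forall>\<^sub>F h in nhds 0. Re (\<rho> k h) > 0" for k
  proof -
    have "isCont (\<rho> k) 0" by (rule smooth_on_imp_isCont[OF \<rho>_smooth I0])
    then have "((\<lambda>h. Re (\<rho> k h)) \<longlongrightarrow> Re (\<rho> k 0)) (nhds 0)"
      by (intro tendsto_intros) (simp add: isCont_def tendsto_at_iff_tendsto_nhds)
    then show ?thesis by (rule order_tendstoD) (simp add: \<rho>_def)
  qed
  have ev5: "\<forall>\<^sub>F h in nhds 0. \<bar>h\<bar> < \<delta>1"
    using eventually_nhds_in_open[of ?I 0] I0 by (auto elim: eventually_mono)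
  have "\<forall>\<^sub>F h in nhds 0. (\<forall>i j. j \<noteq> partner i \<longrightarrow> c i j h \<noteq> 0) \<and> (\<forall>k. \<Omega> (Inl k) (Inr k) h \<noteq> 0) \<and>
      (\<forall>i j. j \<noteq> partner i \<longrightarrow> cnj (\<mu> i h) - \<mu> j h \<noteq> 0) \<and> (\<forall>k. Re (\<rho> k h) > 0) \<and> \<bar>h\<bar> < \<delta>1"
    by (intro eventually_conj eventually_all_finite ev1 ev2 ev3 ev4 ev5)
  then obtain \<delta> where \<delta>: "\<delta> > 0"
    and good: "\<And>h i j. \<bar>h\<bar> < \<delta> \<Longrightarrow> j \<noteq> partner i \<Longrightarrow> c i j h \<noteq> 0"
      "\<And>h k. \<bar>h\<bar> < \<delta> \<Longrightarrow> \<Omega> (Inl k) (Inr k) h \<noteq> 0"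
      "\<And>h i j. \<bar>h\<bar> < \<delta> \<Longrightarrow> j \<noteq> partner i \<Longrightarrow> cnj (\<mu> i h) \<noteq> \<mu> j h"
      "\<And>h k. \<bar>h\<bar> < \<delta> \<Longrightarrow> Re (\<rho> k h) > 0" "\<And>h. \<bar>h\<bar> < \<delta> \<Longrightarrow> \<bar>h\<bar> < \<delta>1"
    unfolding eventually_nhds_metric dist_real_def by auto
  let ?D = "{-\<delta><..<\<delta>}"
  have D: "\<bar>h\<bar> < \<delta>" if "h \<in> ?D" for h using that by auto
  have D': "h \<in> ?D" if "\<bar>h\<bar> < \<delta>" for h using that by auto
  have DI: "?D \<subseteq> ?I"
  proof
    fix h assume "h \<in> ?D"
    then have "\<bar>h\<bar> < \<delta>1" by (rule good(5)[OF D])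
    then show "h \<in> ?I" by auto
  qed
  have \<Omega>_zero: "\<Omega> i j h = 0" if h: "\<bar>h\<bar> < \<delta>" and ij: "j \<noteq> partner i" for i j h
  proof (cases "h = 0")
    case True
    with ij show ?thesis by (simp add: \<Omega>0 J_mat_nonpartner)
  next
    case False
    with \<Omega>_eq[OF good(5)[OF h], of i j] good(1)[OF h ij] show ?thesis by (simp add: \<rho>c)
  qed
  \<comment> \<open>It suffices to rescale one eigenvector of each pair; the first of the two is chosen.\<close>
  define s where "s j h = (case j of Inl k \<Rightarrow> \<Omega> (Inl k) (Inr k) h | Inr k \<Rightarrow> 1)"
    for j :: "'n + 'n" and h
  have s0: "s j h \<noteq> 0" if "\<bar>h\<bar> < \<delta>" for j h using good(2)[OF that] by (simp add: s_def split: sum.split)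
  have s_smooth: "smooth_on ?I (s j)" for j
    by (cases j) (simp_all add: s_def[abs_def] \<Omega>_smooth smooth_on_const)
  define M where "M h = (\<chi> i j. V h $ i $ j / s j h)" for h
  have M_smooth: "smooth_on ?D M"
    unfolding M_def[abs_def] using s0 D
    by (intro smooth_intros smooth_on_subset[OF V_smooth DI] smooth_on_subset[OF s_smooth DI]) blast
  have M_col: "column j (M h) = inverse (s j h) *s column j (V h)" for j h
    by (simp add: M_def column_def vec_eq_iff divide_inverse mult.commute)
  have M_symp: "symplectic (M h)" if h: "\<bar>h\<bar> < \<delta>" for h
  proof -
    have "inverse (s i h) * inverse (s j h) * \<Omega> i j h = J_mat $ i $ j" for i j
    proof (cases "j = partner i")
      case False
      then show ?thesis by (simp add: \<Omega>_zero[OF h] J_mat_nonpartner)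
    next
      case True
      have "\<Omega> (Inr k) (Inl k) h = - \<Omega> (Inl k) (Inr k) h" for k
        unfolding \<Omega>_def by (rule symp_form_skew)
      with True good(2)[OF h] show ?thesis
        by (cases i) (simp_all add: s_def J_mat_def)
    qed
    then show ?thesis
      unfolding symplectic_iff_columns M_col symp_form_scale \<Omega>_def by blast
  qed
  have GM: "G h ** M h = M h ** diag_mat (\<lambda>k. \<rho> k h)" if h: "\<bar>h\<bar> < \<delta>" for h
  proof (rule column_eigen_imp_mult_diag)
    fix j
    show "G h *v column j (M h) = \<rho> j h *s column j (M h)"
      unfolding M_col vector_scalar_commute eigG[OF good(5)[OF h]] vector_smult_assoc
      by (simp add: mult.commute)
  qed
  have spec_G: "spectrum (G h) = range (\<lambda>k. \<rho> k h)" if h: "\<bar>h\<bar> < \<delta>" for h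
    by (rule spectrum_diagonalised[OF GM[OF h] symp_inv(1)[OF M_symp[OF h]]])
  \<comment> \<open>For \<open>h \<noteq> 0\<close> conjugation permutes the \<open>\<mu>\<^sub>j\<close>, by continuity in the same way as at \<open>h = 0\<close>.\<close>
  have \<rho>_cnj: "\<rho> (partner i) h = cnj (\<rho> i h)" if h: "\<bar>h\<bar> < \<delta>" for i h
  proof (cases "h = 0")
    case False
    have "cnj (\<rho> i h) \<in> cnj ` spectrum (G h)" by (simp add: spec_G[OF h])
    then have "cnj (\<rho> i h) \<in> spectrum (G h)" by (subst spec)
    then have "cnj (\<rho> i h) \<in> range (\<lambda>k. \<rho> k h)" unfolding spec_G[OF h] .
    then obtain j where j: "cnj (\<rho> i h) = \<rho> j h" by blast
    then have "cnj (\<mu> i h) = \<mu> j h" using False by (simp add: \<rho>_def)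
    then have "j = partner i" using good(3)[OF h] by blast
    with j show ?thesis by simp
  qed (simp add: \<rho>_def)
  have \<rho>_inv: "\<rho> (Inl k) h * \<rho> (Inr k) h = 1" if h: "\<bar>h\<bar> < \<delta>" for k h
    using \<Omega>_eq[OF good(5)[OF h], of "Inl k" "Inr k"] good(2)[OF h, of k] by simp
  have \<rho>_norm: "norm (\<rho> (Inl k) h) = 1" if h: "\<bar>h\<bar> < \<delta>" for k h
  proof -
    have "complex_of_real ((norm (\<rho> (Inl k) h))\<^sup>2) = 1"
      using \<rho>_inv[OF h, of k] \<rho>_cnj[OF h, of "Inl k"] by (simp add: complex_norm_square[symmetric])
    then have "(norm (\<rho> (Inl k) h))\<^sup>2 = 1" by (simp only: of_real_eq_1_iff)
    then show ?thesis by (simp add: power2_eq_1_iff) (smt (verit) norm_ge_zero)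
  qed
  have nonneg: "\<rho> k h \<notin> \<real>\<^sub>\<le>\<^sub>0" if "\<bar>h\<bar> < \<delta>" for k h
    using good(4)[OF that, of k] by (auto simp: complex_nonpos_Reals_iff)
  \<comment> \<open>The logarithms vanish at \<open>h = 0\<close>, so they can be divided by \<open>h\<close>.\<close>
  have "\<exists>g. smooth_on ?D g \<and> (\<forall>h\<in>?D. Ln (\<rho> (Inl k) h) = h *\<^sub>R g h)" for k
  proof -
    have "smooth_on ?D (\<lambda>h. Ln (\<rho> (Inl k) h))"
      by (rule smooth_on_Ln[OF smooth_on_subset[OF \<rho>_smooth DI]]) (use nonneg D in auto)
    then show ?thesis
    proof (rule hadamard_division)
      show "0 \<in> ?D" "Ln (\<rho> (Inl k) 0) = 0" using \<delta> by (simp_all add: \<rho>_def)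
    qed (auto simp only: open_greaterThanLessThan convex_real_interval)
  qed
  then have "\<forall>k. \<exists>g. smooth_on ?D g \<and> (\<forall>h\<in>?D. Ln (\<rho> (Inl k) h) = h *\<^sub>R g h)" by blast
  from choice[OF this] obtain g where
    g: "\<And>k. smooth_on ?D (g k)" "\<And>k h. h \<in> ?D \<Longrightarrow> Ln (\<rho> (Inl k) h) = h *\<^sub>R g k h"
    by blast
  define \<theta> where "\<theta> h = (\<chi> k. Im (g k h))" for h
  have \<theta>_smooth: "smooth_on ?D \<theta>"
    unfolding \<theta>_def[abs_def] by (intro smooth_intros smooth_on_bounded_linear[OF bounded_linear_Im] g(1))
  have exp_\<theta>: "\<rho> (Inl k) h = exp (\<i> * of_real (h * \<theta> h $ k))" if h: "\<bar>h\<bar> < \<delta>" for k h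
  proof -
    have nz: "\<rho> (Inl k) h \<noteq> 0" using \<rho>_norm[OF h, of k] by auto
    have "Re (Ln (\<rho> (Inl k) h)) = 0" using nz \<rho>_norm[OF h, of k] by simp
    moreover have "Im (Ln (\<rho> (Inl k) h)) = h * \<theta> h $ k" using g(2)[OF D'[OF h], of k] by (simp add: \<theta>_def)
    ultimately have "Ln (\<rho> (Inl k) h) = \<i> * of_real (h * \<theta> h $ k)" by (simp add: complex_eq_iff)
    then show ?thesis using exp_Ln[OF nz] by simp
  qed
  have \<rho>_flow: "\<rho> j h = exp (\<i> * of_real (h * freq (\<theta> h) j))" if h: "\<bar>h\<bar> < \<delta>" for j h
  proof (cases j)
    case (Inl k)
    then show ?thesis using exp_\<theta>[OF h] by (simp add: freq_def)
  next
    case (Inr k)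
    have "\<rho> (Inr k) h = cnj (\<rho> (Inl k) h)" using \<rho>_cnj[OF h, of "Inl k"] by simp
    then show ?thesis using exp_\<theta>[OF h, of k] by (simp add: Inr freq_def exp_cnj)
  qed
  have diag: "G h ** M h = M h ** flow_diag h (\<theta> h)" if h: "\<bar>h\<bar> < \<delta>" for h
    using GM[OF h] \<rho>_flow[OF h] by (simp add: flow_diag_def)
  have \<delta>_ev: "\<forall>\<^sub>F h in at 0. \<bar>h\<bar> < \<delta>"
    using eventually_nhds_in_open[of ?D 0] \<delta> by (auto elim: eventually_mono simp: eventually_at_filter)
  have pert: "vanishes p (\<lambda>h. V h - mat 1)"
    "\<And>j. vanishes (Suc p) (\<lambda>h. 1 + of_real h * \<mu> j h - exp (\<i> * of_real (h * freq \<omega> j)))"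
  proof -
    have 1: "((\<lambda>h. V h $ i $ j) \<longlongrightarrow> V 0 $ i $ j) (at 0)" for i j
      by (rule smooth_on_tendsto[OF V_smooth I0])
    have 2: "(\<mu> j \<longlongrightarrow> \<i> * of_real (freq \<omega> j)) (at 0)" for j
      using smooth_on_tendsto[OF \<mu>_smooth I0, of j] by (simp add: \<mu>0 d_def)
    have 3: "\<forall>\<^sub>F h in at 0. \<forall>j. G h *v column j (V h) = (1 + of_real h * \<mu> j h) *s column j (V h)
        \<and> V h $ j $ j = 1"
      using \<delta>_ev by eventually_elim (use eigG Vkk good(5) in \<open>simp add: \<rho>_def\<close>)
    note * = vanishes_of_nonresonant_perturbation[OF E[unfolded flow_diag_def] 1 2 inj 3]
    show "vanishes p (\<lambda>h. V h - mat 1)" by (rule *(1))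
    show "vanishes (Suc p) (\<lambda>h. 1 + of_real h * \<mu> j h - exp (\<i> * of_real (h * freq \<omega> j)))" for j by (rule *(2))
  qed
  have Vv: "vanishes p (\<lambda>h. V h $ i $ j - mat 1 $ i $ j)" for i j
    using pert(1) by (simp add: vanishes_vec_iff)
  have V_lim: "((\<lambda>h. V h $ i $ j) \<longlongrightarrow> mat 1 $ i $ j) (at 0)" for i j
    using smooth_on_tendsto[OF V_smooth I0, of i j] by (simp add: V0)
  have \<Omega>v: "vanishes p (\<lambda>h. \<Omega> i j h - \<Omega> i j 0)" for i j
  proof -
    have "vanishes p (\<lambda>h. \<Sum>k\<in>UNIV.
        (V h $ Inl k $ i * V h $ Inr k $ j - mat 1 $ Inl k $ i * mat 1 $ Inr k $ j)
        + - (V h $ Inr k $ i * V h $ Inl k $ j - mat 1 $ Inr k $ i * mat 1 $ Inl k $ j))"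
      by (intro vanishes_sum vanishes_add vanishes_uminus vanishes_mult_diff Vv V_lim)
    then show ?thesis
      by (simp add: \<Omega>_def symp_form_def column_def V0 algebra_simps flip: sum_subtractf)
  qed
  have s_one: "s j 0 = 1" for j by (simp add: s_def \<Omega>0 J_mat_def split: sum.split)
  have s_lim: "((\<lambda>h. inverse (s j h)) \<longlongrightarrow> 1) (at 0)" for j
    using tendsto_inverse[OF smooth_on_tendsto[OF s_smooth I0], of j] by (simp add: s_one)
  have sv: "vanishes p (\<lambda>h. s j h - 1)" for j
  proof (cases j)
    case (Inl k)
    then show ?thesis using \<Omega>v[of "Inl k" "Inr k"] by (simp add: s_def \<Omega>0 J_mat_def)
  qed (simp add: s_def vanishes_zero)
  have s_inv: "vanishes p (\<lambda>h. inverse (s j h) - 1)" for j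
  proof -
    have "vanishes p (\<lambda>h. - ((s j h - 1) * inverse (s j h)))"
      by (intro vanishes_uminus vanishes_mult[OF sv s_lim])
    moreover have "\<forall>\<^sub>F h in at 0. norm (- ((s j h - 1) * inverse (s j h))) = norm (inverse (s j h) - 1)"
      using \<delta>_ev
    proof eventually_elim
      case (elim h)
      have "- ((s j h - 1) * inverse (s j h)) = inverse (s j h) - 1"
        using s0[OF elim, of j] by (simp add: left_diff_distrib)
      then show ?case by simp
    qed
    ultimately show ?thesis by (rule vanishes_cong[THEN iffD1, rotated])
  qed
  have Mv: "vanishes p (\<lambda>h. M h - mat 1)"
  proof -
    have "vanishes p (\<lambda>h. V h $ i $ j * inverse (s j h) - mat 1 $ i $ j * 1)" for i j
      by (intro vanishes_mult_diff Vv s_inv s_lim)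
    then show ?thesis by (simp add: vanishes_vec_iff M_def divide_inverse)
  qed
  have \<theta>v: "vanishes p (\<lambda>h. \<theta> h - \<omega>)"
  proof -
    have "vanishes p (\<lambda>h. \<theta> h $ k - \<omega> $ k)" for k
    proof -
      let ?x = "\<lambda>h. h * (\<theta> h $ k - \<omega> $ k)"
      have "((\<lambda>h. \<theta> h $ k) \<longlongrightarrow> \<theta> 0 $ k) (at 0)"
        by (rule smooth_on_tendsto[OF smooth_on_vec_nth[OF \<theta>_smooth]]) (use \<delta> in simp)
      from tendsto_mult[OF tendsto_ident_at tendsto_diff[OF this tendsto_const]]
      have "(?x \<longlongrightarrow> 0 * (\<theta> 0 $ k - \<omega> $ k)) (at 0)" .
      then have x0: "(?x \<longlongrightarrow> 0) (at 0)" by simp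
      have "\<forall>\<^sub>F h in at 0. norm (1 + of_real h * \<mu> (Inl k) h - exp (\<i> * of_real (h * freq \<omega> (Inl k))))
          = norm (exp (\<i> * complex_of_real (?x h)) - 1)"
        using \<delta>_ev
      proof eventually_elim
        case (elim h)
        let ?e = "exp (\<i> * complex_of_real (h * \<omega> $ k))"
        have "\<i> * complex_of_real (h * \<theta> h $ k) = \<i> * of_real (h * \<omega> $ k) + \<i> * of_real (?x h)"
          by (simp add: algebra_simps)
        then have "1 + of_real h * \<mu> (Inl k) h - ?e = ?e * exp (\<i> * of_real (?x h)) - ?e * 1"
          using exp_\<theta>[OF elim, of k] by (simp only: \<rho>_def exp_add mult_1_right)
        then have "norm (1 + of_real h * \<mu> (Inl k) h - ?e) = norm (?e * (exp (\<i> * of_real (?x h)) - 1))"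
          by (simp only: right_diff_distrib)
        then show ?case unfolding norm_mult by (simp add: freq_def)
      qed
      from vanishes_cong[THEN iffD1, OF this pert(2)]
      have "vanishes (Suc p) (\<lambda>h. complex_of_real (?x h))" by (rule angle_vanishes[OF x0])
      then have "vanishes p (\<lambda>h. complex_of_real (\<theta> h $ k - \<omega> $ k))"
        by (rule vanishes_divide) simp
      then show ?thesis by (simp only: vanishes_def norm_of_real real_norm_def)
    qed
    then show ?thesis by (simp add: vanishes_vec_iff)
  qed
  show ?thesis by (rule that[OF \<delta> M_smooth \<theta>_smooth M_symp diag Mv \<theta>v])
qed

section \<open>Conjugation to a linear Hamiltonian flow\<close>

text \<open>
  It remains to pass to the diagonal coordinates by \<open>K = P\<^sup>-\<^sup>1 T\<close>, with inverse \<open>L\<close>, and back.  If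
  \<open>M\<close> diagonalises \<open>G\<close>, then \<open>R = T M\<^sup>-\<^sup>1 L\<close> conjugates \<open>S\<close> to the real flow with the new
  frequencies, and \<open>T L = P\<close> makes \<open>R\<close> close to \<open>P\<close>.  The cut-off \<open>\<psi>\<close> extends both families to
  all \<open>h\<close>.
\<close>

theorem theorem4p1:
  fixes H P :: "(real, 'n::finite) block_matrix"
    and S :: "real \<Rightarrow> (complex, 'n) block_matrix"
    and \<omega> :: "real ^ 'n"
    and p :: nat
  assumes H_symmetric: "transpose H = H"
    and S_symplectic: "\<And>h. symplectic (S h)"
    and S_smooth: "smooth S"
    and S_spectrum: "\<And>h. spectrum (S h) = cnj ` spectrum (S h)"
    and p_ge_1: "p \<ge> 1"
    and S_consistent:
      "(\<lambda>h. norm (S h - complex_mat (mat_exp (h *\<^sub>R (J_mat ** H))))) \<in> O[at 0](\<lambda>h. h ^ (p + 1))"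
    and P_symplectic: "symplectic P"
    and H_integrable: "H = transpose P ** D_mat \<omega> ** P"
    and \<omega>_non_resonant: "non_resonant \<omega>"
  shows "\<exists>(\<omega>' :: real \<Rightarrow> real ^ 'n) (P' :: real \<Rightarrow> (complex, 'n) block_matrix).
           smooth \<omega>' \<and> smooth P' \<and> (\<forall>h. symplectic (P' h)) \<and>
           (\<lambda>h. norm (P' h - complex_mat P)) \<in> O[at 0](\<lambda>h. h ^ p) \<and>
           (\<lambda>h. norm (\<omega>' h - \<omega>)) \<in> O[at 0](\<lambda>h. h ^ p) \<and>
           (\<forall>\<^sub>F h in nhds 0.
              S h = matrix_inv (P' h) **
                    complex_mat (mat_exp (h *\<^sub>R (J_mat ** D_mat (\<omega>' h)))) ** P' h)"
proof -
  let ?P = "complex_mat P"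
  define T where "T = (eigenbasis :: (complex, 'n) block_matrix)"
  have T: "symplectic T" unfolding T_def by (rule symplectic_eigenbasis)
  have P: "symplectic ?P" by (rule symplectic_complex_mat[OF P_symplectic])
  define K where "K = symp_inv ?P ** T"
  define L where "L = symp_inv T ** ?P"
  have K: "symplectic K" and L: "symplectic L"
    unfolding K_def L_def by (intro symplectic_mult symplectic_symp_inv T P)+
  have KL: "K ** L = mat 1" and LK: "L ** K = mat 1"
    by (simp_all add: K_def L_def matrix_mul_assoc matrix_cancel_right symp_inv[OF T] symp_inv[OF P])
  have rot: "complex_mat (rotation h \<theta>) = T ** flow_diag h \<theta> ** symp_inv T" for h and \<theta> :: "real ^ 'n"
    using rotation_eigenbasis[of h \<theta>] matrix_cancel_right[OF symp_inv(2)[OF T]] by (metis T_def)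
  \<comment> \<open>Since \<open>J P\<^sup>T = P\<^sup>-\<^sup>1 J\<close>, the generator \<open>J H\<close> is conjugate to \<open>J D\<^sub>\<omega>\<close> by \<open>P\<close>.\<close>
  have flow: "complex_mat (mat_exp (h *\<^sub>R (J_mat ** H))) = K ** flow_diag h \<omega> ** L" for h
  proof -
    have "symp_inv P ** (J_mat ** D_mat \<omega>) ** P = - (J_mat ** transpose P ** (J_mat ** J_mat) ** D_mat \<omega> ** P)"
      by (simp add: symp_inv_def minus_matrix_mult matrix_mul_assoc)
    then have "J_mat ** H = symp_inv P ** (J_mat ** D_mat \<omega>) ** P"
      by (simp add: J_mat_square H_integrable minus_matrix_mult matrix_mult_minus matrix_mul_assoc)
    then have "mat_exp (h *\<^sub>R (J_mat ** H)) = symp_inv P ** rotation h \<omega> ** P"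
      by (simp add: mat_exp_conj_rotation[OF symp_inv(2)[OF P_symplectic] symp_inv(1)[OF P_symplectic]])
    then have "complex_mat (mat_exp (h *\<^sub>R (J_mat ** H))) = complex_mat (symp_inv P) ** complex_mat (rotation h \<omega>) ** ?P"
      by (simp add: complex_mat_mult)
    moreover have "complex_mat (symp_inv P) = symp_inv ?P"
    proof -
      have "complex_mat (symp_inv P) ** ?P = complex_mat (mat 1)"
        by (simp add: symp_inv(1)[OF P_symplectic] flip: complex_mat_mult)
      also have "\<dots> = mat 1" by (simp add: complex_mat_def mat_def vec_eq_iff)
      finally have "complex_mat (symp_inv P) ** ?P ** symp_inv ?P = mat 1 ** symp_inv ?P" by simp
      then show ?thesis by (simp add: matrix_cancel_right[OF symp_inv(2)[OF P]])
    qed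
    ultimately show ?thesis by (simp add: rot K_def L_def matrix_mul_assoc)
  qed
  define G where "G h = L ** S h ** K" for h
  have G_smooth: "smooth_on UNIV G"
    unfolding G_def[abs_def]
    by (intro smooth_intros S_smooth[unfolded smooth_iff_smooth_on])
  have G_symp: "symplectic (G h)" for h
    unfolding G_def by (intro symplectic_mult K L S_symplectic)
  have G_spec: "spectrum (G h) = cnj ` spectrum (G h)" for h
    unfolding G_def spectrum_similar[OF LK KL] by (rule S_spectrum)
  have err: "L ** (S h - complex_mat (mat_exp (h *\<^sub>R (J_mat ** H)))) ** K = G h - flow_diag h \<omega>" for h
    by (simp add: matrix_diff_conj flow G_def matrix_mul_assoc LK matrix_cancel_right)
  have "vanishes (Suc p) (\<lambda>h. S h - complex_mat (mat_exp (h *\<^sub>R (J_mat ** H))))"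
    using S_consistent by (simp add: vanishes_iff_bigo)
  then have G_flow: "vanishes (Suc p) (\<lambda>h. G h - flow_diag h \<omega>)"
    unfolding err[symmetric] by (rule vanishes_matrix_mult)
  obtain \<delta> M \<theta> where \<delta>: "\<delta> > 0" and M: "smooth_on {-\<delta><..<\<delta>} M" and \<theta>: "smooth_on {-\<delta><..<\<delta>} \<theta>"
    and M_symp: "\<And>h. \<bar>h\<bar> < \<delta> \<Longrightarrow> symplectic (M h)"
    and GM: "\<And>h. \<bar>h\<bar> < \<delta> \<Longrightarrow> G h ** M h = M h ** flow_diag h (\<theta> h)"
    and Mv: "vanishes p (\<lambda>h. M h - mat 1)" and \<theta>v: "vanishes p (\<lambda>h. \<theta> h - \<omega>)"
    by (fact symplectic_diagonalisation[OF G_smooth G_symp G_spec p_ge_1 G_flow \<omega>_non_resonant])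
  obtain \<psi> where \<psi>: "smooth_on UNIV \<psi>" "\<And>h. \<bar>\<psi> h\<bar> < \<delta>" "\<forall>\<^sub>F h in nhds 0. \<psi> h = h"
    by (fact smooth_cutoff[OF \<delta>])
  have \<psi>_at: "\<forall>\<^sub>F h in at 0. \<psi> h = h"
    using \<psi>(3) by (auto simp: eventually_at_filter elim: eventually_mono)
  have \<psi>_image: "\<psi> ` UNIV \<subseteq> {-\<delta><..<\<delta>}" using \<psi>(2) by (auto simp: abs_less_iff minus_less_iff)
  define R where "R h = T ** symp_inv (M h) ** L" for h
  have R_smooth: "smooth_on {-\<delta><..<\<delta>} R"
    unfolding R_def[abs_def] symp_inv_def by (intro smooth_intros M)
  have R_symp: "symplectic (R h)" if "\<bar>h\<bar> < \<delta>" for h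
    unfolding R_def by (intro symplectic_mult T L symplectic_symp_inv M_symp that)
  have Rv: "vanishes p (\<lambda>h. R h - ?P)"
  proof -
    have "vanishes p (\<lambda>h. transpose (M h - mat 1))"
      using Mv by (simp add: vanishes_vec_iff transpose_def)
    then have "vanishes p (\<lambda>h. T ** ((- J_mat) ** transpose (M h - mat 1) ** J_mat) ** L)"
      by (intro vanishes_matrix_mult)
    moreover have "T ** ((- J_mat) ** transpose (M h - mat 1) ** J_mat) ** L = R h - ?P" for h
    proof -
      have "transpose (M h - mat 1) = transpose (M h) - mat 1"
        by (simp add: transpose_def mat_def vec_eq_iff)
      then have "(- J_mat) ** transpose (M h - mat 1) ** J_mat = symp_inv (M h) - mat 1"
        by (simp add: matrix_diff_conj symp_inv_def minus_matrix_mult J_mat_square)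
      moreover have "T ** L = ?P"
        by (simp add: L_def matrix_mul_assoc symp_inv(2)[OF T])
      ultimately show ?thesis by (simp add: R_def matrix_diff_conj)
    qed
    ultimately show ?thesis by simp
  qed
  have conj: "S h = matrix_inv (R h) ** complex_mat (mat_exp (h *\<^sub>R (J_mat ** D_mat (\<theta> h)))) ** R h"
    if h: "\<bar>h\<bar> < \<delta>" for h
  proof -
    note Mi = symp_inv[OF M_symp[OF h]] and Ti = symp_inv[OF T]
    note cancel = matrix_cancel_right[OF Mi(1)] matrix_cancel_right[OF Mi(2)] matrix_cancel_right[OF Ti(1)]
      matrix_cancel_right[OF Ti(2)] matrix_cancel_right[OF KL] matrix_cancel_right[OF LK]
    have inv: "matrix_inv (R h) = K ** M h ** symp_inv T"
      by (rule matrix_inv_unique) (simp_all add: R_def matrix_mul_assoc cancel KL Ti)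
    have "S h = K ** (G h ** M h) ** symp_inv (M h) ** L"
      by (simp add: G_def matrix_mul_assoc cancel KL)
    also have "\<dots> = matrix_inv (R h) ** complex_mat (rotation h (\<theta> h)) ** R h"
      unfolding GM[OF h] inv rot by (simp add: R_def matrix_mul_assoc cancel)
    finally show ?thesis by (simp add: mat_exp_rotation)
  qed
  show ?thesis
  proof (intro exI conjI allI)
    show "smooth (\<lambda>h. \<theta> (\<psi> h))" "smooth (\<lambda>h. R (\<psi> h))"
      unfolding smooth_iff_smooth_on
      by (rule smooth_on_compose[OF _ _ \<psi>(1) _ \<psi>_image]; simp add: \<theta> R_smooth)+
    show "symplectic (R (\<psi> h))" for h by (rule R_symp[OF \<psi>(2)])
    have "vanishes p (\<lambda>h. R (\<psi> h) - ?P)"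
      by (rule vanishes_cong[THEN iffD1, OF _ Rv]) (use \<psi>_at in \<open>eventually_elim, simp\<close>)
    then show "(\<lambda>h. norm (R (\<psi> h) - ?P)) \<in> O[at 0](\<lambda>h. h ^ p)" by (simp add: vanishes_iff_bigo)
    have "vanishes p (\<lambda>h. \<theta> (\<psi> h) - \<omega>)"
      by (rule vanishes_cong[THEN iffD1, OF _ \<theta>v]) (use \<psi>_at in \<open>eventually_elim, simp\<close>)
    then show "(\<lambda>h. norm (\<theta> (\<psi> h) - \<omega>)) \<in> O[at 0](\<lambda>h. h ^ p)" by (simp add: vanishes_iff_bigo)
    show "\<forall>\<^sub>F h in nhds 0. S h = matrix_inv (R (\<psi> h)) **
        complex_mat (mat_exp (h *\<^sub>R (J_mat ** D_mat (\<theta> (\<psi> h))))) ** R (\<psi> h)"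
      using \<psi>(3)
    proof eventually_elim
      case (elim h)
      then show ?case using conj[of h] \<psi>(2)[of h] by simp
    qed
  qed
qed

end
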